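(* Let $h>0$, $\alpha>2$, $\beta\ge0$, and $V\in C^{\alpha,\beta,2}$ as in the setting. Then there exists a constant $c_{\mathcal{M}}$ depending only on $c_v,h,\alpha$ such that $$\mathcal{M}=\mathcal{M}^{(0)}+\mathcal{M}^{(d)}+\mathcal{M}^{(1)}+\mathcal{M}^{(2)},\qquad |\mathcal{M}^{(2)}_{jk}|\le \frac{c_{\mathcal{M}}e^{-\beta|j-k|}}{\langle j\rangle\langle k\rangle\langle j-k\rangle^{\alpha-1}}\quad\text{for all }j,k\in\mathbb{Z}.$$
   Context: Setting. $\mathbb{T}=\mathbb{R}/2\pi\mathbb{Z}$, $h>0$. $V:\mathbb{T}\times\mathbb{R}\to\mathbb{R}$ is real-valued and $2\pi$-periodic in $t$, with Fourier expansion $V(x,t)=\sum_{k\in\mathbb{Z}}v_k(t)e^{ikx}$ (so $v_{-k}=\overline{v_k}$), and it is assumed that $v_0(t)\equiv 0$. Notation: $\langle k\rangle=|k|+1$; $\delta$ is the Kronecker delta; $e^{\frac{t}{ih}k^2}=e^{-itk^2/h}$. For $\alpha,\gamma\in\mathbb{N}$ (or real $\alpha$) and $\beta\ge0$, $V\in C^{\alpha,\beta,\gamma}$ means $V$ is $C^\gamma$ in $t$ and there is $c_v>0$ with $\|v_k\|_{C^\gamma}\le c_v e^{-\beta|k|}\langle k\rangle^{-\alpha}$ for all $k\in\mathbb{Z}$, where $\|\cdot\|_{C^\gamma}$ is the sup over $t$ of the function and its first $\gamma$ derivatives. The Schrödinger equation $ih\partial_t\psi=-\partial_x^2\psi+V\psi$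 on $L^2(\mathbb{T})$, in Fourier coordinates $\psi=\sum\psi_ke^{ikx}$, is the system $ih\dot\psi_k=k^2\psi_k+\sum_{j\in\mathbb{Z}}v_{k-j}(t)\psi_j$ on $l^2(\mathbb{Z})$. $W(t)$ denotes its fundamental solution (unitary propagator, $W(0)=I$), operators on $l^2(\mathbb{Z})$ are identified with infinite matrices in the basis $(e^{ikx})_{k\in\mathbb{Z}}$ (so the $k_0$-th column of $W(t)$ is the solution with $\psi_k(0)=\delta_{kk_0}$), and $\mathcal{M}=W(2\pi)$ is the monodromy operator. Define the infinite matrices $\mathcal{M}^{(0)}_{jk}=\delta_{jk}e^{\frac{2\pi}{ih}k^2}$, $\mathcal{M}^{(d)}_{jk}=\delta_{-j,k}\,\frac{e^{\frac{2\pi}{ih}k^2}}{ih}\int_0^{2\pi}v_{-2k}(\tau)\,d\tau$, and $\mathcal{M}^{(1)}_{jk}=0$ if $j^2=k^2$, $\mathcal{M}^{(1)}_{jk}=\frac{v_{j-k}(0)\big(e^{\frac{2\pi}{ih}k^2}-e^{\frac{2\pi}{ih}j^2}\big)}{k^2-j^2}$ if $j^2\ne k^2$. *)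

theory Defs
  imports "HOL-Analysis.Analysis"
begin

text \<open>Fourier coefficients of the potential: v k t = v_k(t), for k an integer, t real.\<close>

definition jbr :: "int \<Rightarrow> real" where
  "jbr k = real_of_int \<bar>k\<bar> + 1"

text \<open>V in C^{alpha,beta,2} (real-valued, 2pi-periodic in t, zero mean), with constant c_v:
  each v_k is C^2 and its values and first two derivatives are bounded in modulus by
  c_v e^{-beta |k|} <k>^{-alpha}.\<close>
definition potential_class :: "real \<Rightarrow> real \<Rightarrow> real \<Rightarrow> (int \<Rightarrow> real \<Rightarrow> complex) \<Rightarrow> bool" where
  "potential_class \<alpha> \<beta> c_v v \<longleftrightarrow>
     (\<forall>k t. v (-k) t = cnj (v k t)) \<and>
     (\<forall>t. v 0 t = 0) \<and>
     (\<forall>k t. v k (t + 2 * pi) = v k t) \<and>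
     (\<forall>k. \<exists>d1 d2. (\<forall>t. (v k has_vector_derivative d1 t) (at t)) \<and>
                 (\<forall>t. (d1 has_vector_derivative d2 t) (at t)) \<and>
                 continuous_on UNIV d2 \<and>
                 (\<forall>t. cmod (v k t) \<le> c_v * exp (- \<beta> * \<bar>k\<bar>) * jbr k powr (- \<alpha>) \<and>
                      cmod (d1 t) \<le> c_v * exp (- \<beta> * \<bar>k\<bar>) * jbr k powr (- \<alpha>) \<and>
                      cmod (d2 t) \<le> c_v * exp (- \<beta> * \<bar>k\<bar>) * jbr k powr (- \<alpha>)))"

text \<open>W t j k is the (j,k) matrix entry of the fundamental solution W(t) of
  i h psi_k' = k^2 psi_k + sum_j v_{k-j}(t) psi_j on l^2(Z):
  its k0-th column is the solution with psi_k(0) = delta_{k k0}; it is unitary, so each column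
  has l^2 norm 1 at every time.\<close>
definition fundamental_solution :: "real \<Rightarrow> (int \<Rightarrow> real \<Rightarrow> complex) \<Rightarrow> (real \<Rightarrow> int \<Rightarrow> int \<Rightarrow> complex) \<Rightarrow> bool" where
  "fundamental_solution h v W \<longleftrightarrow>
     (\<forall>j k. W 0 j k = (if j = k then 1 else 0)) \<and>
     (\<forall>t k. ((\<lambda>j. (cmod (W t j k))\<^sup>2) has_sum 1) UNIV) \<and>
     (\<forall>t j k. ((\<lambda>s. W s j k) has_vector_derivative
          ((of_int j ^ 2 * W t j k + (\<Sum>\<^sub>\<infinity>l. v (j - l) t * W t l k)) / (\<i> * of_real h))) (at t))"

definition monodromy :: "(real \<Rightarrow> int \<Rightarrow> int \<Rightarrow> complex) \<Rightarrow> int \<Rightarrow> int \<Rightarrow> complex" where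
  "monodromy W = W (2 * pi)"

definition ph :: "real \<Rightarrow> int \<Rightarrow> complex" where
  "ph h k = exp (- \<i> * of_real (2 * pi) * of_int (k ^ 2) / of_real h)"

definition M0 :: "real \<Rightarrow> int \<Rightarrow> int \<Rightarrow> complex" where
  "M0 h j k = (if j = k then ph h k else 0)"

definition Md :: "real \<Rightarrow> (int \<Rightarrow> real \<Rightarrow> complex) \<Rightarrow> int \<Rightarrow> int \<Rightarrow> complex" where
  "Md h v j k = (if -j = k then ph h k / (\<i> * of_real h) * integral {0..2*pi} (v (-2*k)) else 0)"

definition M1 :: "real \<Rightarrow> (int \<Rightarrow> real \<Rightarrow> complex) \<Rightarrow> int \<Rightarrow> int \<Rightarrow> complex" where
  "M1 h v j k = (if j^2 = k^2 then 0
     else v (j - k) 0 * (ph h k - ph h j) / of_int (k^2 - j^2))"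

end

theory Submission
  imports Defs
begin

text \<open>In the interaction picture \<open>\<phi>\<^sub>j(t) = exp(i t j\<^sup>2 / h) \<psi>\<^sub>j(t)\<close> the equation becomes
  \<open>\<phi>\<^sub>j' = \<Sum>\<^sub>l a\<^sub>j\<^sub>l \<phi>\<^sub>l\<close>, where \<open>a\<^sub>j\<^sub>l\<close> oscillates with frequency \<open>(j\<^sup>2 - l\<^sup>2) / h\<close>. Hence its primitive
  \<open>B\<^sub>j\<^sub>l\<close> gains a factor \<open>1 / max(|j|, |l|)\<close>; when \<open>l = - j\<close> there is no oscillation and the gain is taken
  from the decay of the potential, which is why the exponent drops to \<open>\<alpha> - 1\<close>. The weights
  \<open>exp(- \<beta> |n|) (|n| + 1)\<^bsup>- p\<^esup>\<close> with \<open>p > 1\<close> are convolution-stable uniformly in \<open>\<beta>\<close>, so all sums over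
  intermediate modes reproduce the same weight.

  The first Dyson term is \<open>Md\<close> on the antidiagonal and elsewhere the boundary terms \<open>M1\<close> of one integration
  by parts, up to the remainder of a second one. In the third- and higher-order part every mode pair supplies one gain
  on each side. The second-order term \<open>\<integral> a\<^sub>j\<^sub>l B\<^sub>l\<^sub>k\<close> has the residual phase \<open>(j\<^sup>2 - k\<^sup>2) / h\<close>, which can
  again be integrated by parts unless \<open>j = \<plusminus> k\<close>: for \<open>j = - k\<close> the decay of the potential suffices, and for
  \<open>j = k\<close> the modes \<open>l\<close> and \<open>2 k - l\<close> cancel to leading order.\<close>

subsection \<open>Weights on the integers\<close>

lemma jbr_ge_1: "jbr k \<ge> 1"
  by (simp add: jbr_def)

lemma jbr_pos [simp]: "jbr k > 0"
  using jbr_ge_1[of k] by linarith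

lemma jbr_nonzero [simp]: "jbr k \<noteq> 0"
  using jbr_pos[of k] by linarith

lemma jbr_nonneg [simp]: "jbr k \<ge> 0"
  using jbr_pos[of k] by linarith

lemma jbr_minus [simp]: "jbr (- k) = jbr k"
  by (simp add: jbr_def)

lemma jbr_add_le: "jbr (a + b) \<le> jbr a * jbr b"
proof -
  have "real_of_int \<bar>a + b\<bar> \<le> real_of_int \<bar>a\<bar> + real_of_int \<bar>b\<bar>"
    by linarith
  moreover have "jbr a * jbr b
      = real_of_int \<bar>a\<bar> * real_of_int \<bar>b\<bar> + real_of_int \<bar>a\<bar> + real_of_int \<bar>b\<bar> + 1"
    by (simp add: jbr_def algebra_simps)
  moreover have "0 \<le> real_of_int \<bar>a\<bar> * real_of_int \<bar>b\<bar>"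
    by simp
  ultimately show ?thesis
    unfolding jbr_def[of "a + b"] by linarith
qed

lemma jbr_le_mult_diff: "jbr j \<le> jbr l * jbr (j - l)"
  using jbr_add_le[of l "j - l"] by simp

lemma jbr_mono: "\<bar>a\<bar> \<le> \<bar>b\<bar> \<Longrightarrow> jbr a \<le> jbr b"
  by (simp add: jbr_def)

text \<open>Factor into (l - k)(l + k). Nonzero integers of moduli x and y satisfy x + y - 1 \<le>
  xy, while x + y is at least 2|k| and 2|l|. There are thus no small divisors: a nonzero frequency
  grows at least linearly in either mode.\<close>

lemma jbr_le_square_diff:
  assumes "l\<^sup>2 \<noteq> k\<^sup>2"
  shows "jbr k \<le> 2 * \<bar>real_of_int (l\<^sup>2 - k\<^sup>2)\<bar>" "jbr l \<le> 2 * \<bar>real_of_int (l\<^sup>2 - k\<^sup>2)\<bar>"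
proof -
  define x y where "x = \<bar>l - k\<bar>" and "y = \<bar>l + k\<bar>"
  have f: "l\<^sup>2 - k\<^sup>2 = (l - k) * (l + k)"
    by (simp add: power2_eq_square algebra_simps)
  have "(l - k) * (l + k) \<noteq> 0"
    using assms f by (metis eq_iff_diff_eq_0)
  then have xy: "x \<ge> 1" "y \<ge> 1"
    unfolding x_def y_def by auto
  have "0 \<le> (x - 1) * (y - 1)"
    using xy by simp
  then have "x + y - 1 \<le> x * y"
    by (simp add: algebra_simps)
  moreover have "x * y = \<bar>l\<^sup>2 - k\<^sup>2\<bar>"
    by (simp add: f x_def y_def abs_mult)
  ultimately have 1: "x + y - 1 \<le> \<bar>l\<^sup>2 - k\<^sup>2\<bar>"
    by simp
  have "2 * \<bar>k\<bar> \<le> x + y"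
    unfolding x_def y_def by linarith
  moreover have "2 * \<bar>l\<bar> \<le> x + y"
    unfolding x_def y_def by linarith
  ultimately have "\<bar>k\<bar> + 1 \<le> 2 * (x + y - 1)" "\<bar>l\<bar> + 1 \<le> 2 * (x + y - 1)"
    using xy by simp_all
  moreover have "2 * (x + y - 1) \<le> 2 * \<bar>l\<^sup>2 - k\<^sup>2\<bar>"
    by (rule mult_left_mono[OF 1]) simp
  ultimately have "\<bar>k\<bar> + 1 \<le> 2 * \<bar>l\<^sup>2 - k\<^sup>2\<bar>" "\<bar>l\<bar> + 1 \<le> 2 * \<bar>l\<^sup>2 - k\<^sup>2\<bar>"
    by (blast intro: order_trans)+
  then have "real_of_int (\<bar>k\<bar> + 1) \<le> real_of_int (2 * \<bar>l\<^sup>2 - k\<^sup>2\<bar>)"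
    "real_of_int (\<bar>l\<bar> + 1) \<le> real_of_int (2 * \<bar>l\<^sup>2 - k\<^sup>2\<bar>)"
    by (simp_all only: of_int_le_iff)
  then show "jbr k \<le> 2 * \<bar>real_of_int (l\<^sup>2 - k\<^sup>2)\<bar>" "jbr l \<le> 2 * \<bar>real_of_int (l\<^sup>2 - k\<^sup>2)\<bar>"
    unfolding jbr_def by simp_all
qed

lemma square_diff_pos:
  assumes "l\<^sup>2 \<noteq> k\<^sup>2"
  shows "0 < \<bar>real_of_int (l\<^sup>2 - k\<^sup>2)\<bar>"
  using assms by (simp only: zero_less_abs_iff of_int_eq_0_iff)

lemma summable_on_int_nonneg:
  fixes f :: "int \<Rightarrow> real"
  assumes "summable (\<lambda>n. f (int n))" "\<And>n. f (- n) = f n" "\<And>n. f n \<ge> 0"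
  shows "f summable_on UNIV"
proof -
  have 1: "(\<lambda>n. f (int n)) summable_on UNIV"
    using assms by (intro norm_summable_imp_summable_on) simp
  have "f summable_on range int"
    using 1 by (subst summable_on_reindex) (auto simp: o_def)
  moreover have "f summable_on range (\<lambda>n. - int n)"
    using 1 assms(2) by (subst summable_on_reindex) (auto simp: o_def inj_on_def)
  ultimately have "f summable_on (range int \<union> range (\<lambda>n. - int n))"
    by (rule summable_on_union)
  moreover have "range int \<union> range (\<lambda>n. - int n) = UNIV"
  proof -
    have "x \<in> range int \<union> range (\<lambda>n. - int n)" for x
      by (cases x rule: int_cases2) auto
    then show ?thesis by auto
  qed
  ultimately show ?thesis by simp
qed

lemma jbr_powr_summable:
  assumes "p > 1"
  shows "(\<lambda>n. jbr n powr (- p)) summable_on UNIV"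
proof (rule summable_on_int_nonneg)
  have "summable (\<lambda>n. real n powr (- p))"
    using assms by (simp add: summable_real_powr_iff)
  then have "summable (\<lambda>n. real (Suc n) powr (- p))"
    by (subst summable_Suc_iff)
  then show "summable (\<lambda>n. jbr (int n) powr (- p))"
    by (simp add: jbr_def add.commute)
qed auto

section \<open>Exponential-polynomial weights and their convolution\<close>

definition wt :: "real \<Rightarrow> real \<Rightarrow> int \<Rightarrow> real" where
  "wt \<beta> p n = exp (- \<beta> * \<bar>n\<bar>) * jbr n powr (- p)"

lemma wt_pos [simp]: "wt \<beta> p n > 0"
  by (simp add: wt_def)

lemma wt_nonneg [simp]: "wt \<beta> p n \<ge> 0"
  by (simp add: wt_def)

lemma wt_minus [simp]: "wt \<beta> p (- n) = wt \<beta> p n"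
  by (simp add: wt_def)

lemma wt_shift: "wt \<beta> (p - 1) n = wt \<beta> p n * jbr n"
  by (simp add: wt_def powr_diff powr_minus field_simps)

lemma wt_le_jbr_powr: "\<beta> \<ge> 0 \<Longrightarrow> wt \<beta> p n \<le> jbr n powr (- p)"
  by (simp add: wt_def mult_le_cancel_right1)

lemma wt_summable:
  assumes "\<beta> \<ge> 0" "p > 1"
  shows "(\<lambda>n. wt \<beta> p n) summable_on UNIV"
  by (rule summable_on_comparison_test[OF jbr_powr_summable[OF assms(2)]])
     (auto intro: wt_le_jbr_powr assms)

text \<open>For p > 1 this is 2 zeta(p) - 1. The exponential is dropped so that all constants built
  from it are independent of \<beta>.\<close>

definition jbr_zeta :: "real \<Rightarrow> real" where
  "jbr_zeta p = (\<Sum>\<^sub>\<infinity>n. jbr n powr (- p))"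

definition conv_const :: "real \<Rightarrow> real" where
  "conv_const p = 2 * 2 powr p * jbr_zeta p"

lemma jbr_zeta_nonneg: "jbr_zeta p \<ge> 0"
  by (simp add: jbr_zeta_def infsum_nonneg)

lemma conv_const_nonneg: "conv_const p \<ge> 0"
  by (simp add: conv_const_def jbr_zeta_nonneg)

lemma wt_infsum_le:
  assumes "\<beta> \<ge> 0" "p > 1"
  shows "(\<Sum>\<^sub>\<infinity>n. wt \<beta> p n) \<le> jbr_zeta p"
  unfolding jbr_zeta_def
  by (rule infsum_mono) (auto intro: wt_le_jbr_powr wt_summable jbr_powr_summable assms)

lemma bij_int_diff_left: "bij (\<lambda>l. j - l :: int)"
  by (rule bij_betwI[where g = "\<lambda>l. j - l"]) auto

lemma bij_int_diff_right: "bij (\<lambda>l. l - k :: int)"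
  by (rule bij_betwI[where g = "\<lambda>l. l + k"]) auto

lemma summable_on_diff_left:
  "f summable_on UNIV \<Longrightarrow> (\<lambda>l::int. f (j - l)) summable_on UNIV"
  using summable_on_reindex_bij_betw[OF bij_int_diff_left, of f j] by simp

lemma summable_on_diff_right:
  "f summable_on UNIV \<Longrightarrow> (\<lambda>l::int. f (l - k)) summable_on UNIV"
  using summable_on_reindex_bij_betw[OF bij_int_diff_right, of f k] by simp

lemma infsum_diff_left: "(\<Sum>\<^sub>\<infinity>l::int. f (j - l)) = (\<Sum>\<^sub>\<infinity>l. f l)"
  using infsum_reindex_bij_betw[OF bij_int_diff_left, of f j] by simp

lemma infsum_diff_right: "(\<Sum>\<^sub>\<infinity>l::int. f (l - k)) = (\<Sum>\<^sub>\<infinity>l. f l)"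
  using infsum_reindex_bij_betw[OF bij_int_diff_right, of f k] by simp

text \<open>The larger of \<open>jbr a\<close> and \<open>jbr b\<close> is at least half of \<open>jbr (a + b)\<close>.\<close>
lemma wt_mult_le:
  assumes "\<beta> \<ge> 0" "p \<ge> 0"
  shows "wt \<beta> p a * wt \<beta> p b
           \<le> 2 powr p * (jbr a powr (- p) + jbr b powr (- p)) * wt \<beta> p (a + b)"
proof -
  have half: "jbr y powr (- p) \<le> 2 powr p * jbr (a + b) powr (- p)"
    if "jbr (a + b) \<le> 2 * jbr y" for y
  proof -
    have "(2 * jbr y) powr (- p) \<le> jbr (a + b) powr (- p)"
      using that assms by (intro powr_mono2') auto
    then have "2 powr (- p) * jbr y powr (- p) \<le> jbr (a + b) powr (- p)"
      by (simp add: powr_mult)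
    then show ?thesis
      by (simp add: powr_minus field_simps)
  qed
  have cases: "jbr (a + b) \<le> 2 * jbr a \<or> jbr (a + b) \<le> 2 * jbr b"
  proof -
    have "real_of_int \<bar>a + b\<bar> \<le> real_of_int \<bar>a\<bar> + real_of_int \<bar>b\<bar>"
      by linarith
    then have "jbr (a + b) \<le> jbr a + jbr b"
      unfolding jbr_def by (simp del: of_int_abs)
    then show ?thesis
      by linarith
  qed
  have jj: "jbr a powr (- p) * jbr b powr (- p)
      \<le> 2 powr p * (jbr a powr (- p) + jbr b powr (- p)) * jbr (a + b) powr (- p)"
    using cases
  proof
    assume "jbr (a + b) \<le> 2 * jbr a"
    then have "jbr a powr (- p) * jbr b powr (- p)
        \<le> (2 powr p * jbr (a + b) powr (- p)) * jbr b powr (- p)"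
      by (intro mult_right_mono half) auto
    also have "\<dots> \<le> 2 powr p * (jbr a powr (- p) + jbr b powr (- p)) * jbr (a + b) powr (- p)"
      by (simp add: algebra_simps)
    finally show ?thesis .
  next
    assume "jbr (a + b) \<le> 2 * jbr b"
    then have "jbr a powr (- p) * jbr b powr (- p)
        \<le> jbr a powr (- p) * (2 powr p * jbr (a + b) powr (- p))"
      by (intro mult_left_mono half) auto
    also have "\<dots> \<le> 2 powr p * (jbr a powr (- p) + jbr b powr (- p)) * jbr (a + b) powr (- p)"
      by (simp add: algebra_simps)
    finally show ?thesis .
  qed
  have "real_of_int \<bar>a + b\<bar> \<le> real_of_int \<bar>a\<bar> + real_of_int \<bar>b\<bar>"
    by linarith
  then have "\<beta> * real_of_int \<bar>a + b\<bar> \<le> \<beta> * (real_of_int \<bar>a\<bar> + real_of_int \<bar>b\<bar>)"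
    using assms by (intro mult_left_mono)
  then have ee: "exp (- \<beta> * real_of_int \<bar>a\<bar>) * exp (- \<beta> * real_of_int \<bar>b\<bar>)
      \<le> exp (- \<beta> * real_of_int \<bar>a + b\<bar>)"
    by (simp add: exp_add[symmetric] algebra_simps)
  have "wt \<beta> p a * wt \<beta> p b
      = (exp (- \<beta> * real_of_int \<bar>a\<bar>) * exp (- \<beta> * real_of_int \<bar>b\<bar>)) * (jbr a powr (- p) * jbr b powr (- p))"
    by (simp add: wt_def)
  also have "\<dots> \<le> exp (- \<beta> * real_of_int \<bar>a + b\<bar>) *
      (2 powr p * (jbr a powr (- p) + jbr b powr (- p)) * jbr (a + b) powr (- p))"
    by (rule mult_mono[OF ee jj]) auto
  finally show ?thesis
    by (simp add: wt_def mult_ac)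
qed

text \<open>By \<open>wt_mult_le\<close> the factor \<open>wt \<beta> p (j - k)\<close> comes out of
  the sum. Two translates of the same polynomial series remain, hence the 2 in
  \<open>conv_const\<close>.\<close>

lemma wt_convolution:
  assumes "\<beta> \<ge> 0" "p > 1"
  shows "(\<lambda>l. wt \<beta> p (j - l) * wt \<beta> p (l - k)) summable_on UNIV"
    and "(\<Sum>\<^sub>\<infinity>l. wt \<beta> p (j - l) * wt \<beta> p (l - k)) \<le> conv_const p * wt \<beta> p (j - k)"
proof -
  let ?J = "\<lambda>n. jbr n powr (- p)"
  have s1: "(\<lambda>l. ?J (j - l)) summable_on UNIV"
    by (rule summable_on_diff_left[OF jbr_powr_summable[OF assms(2)]])
  have s2: "(\<lambda>l. ?J (l - k)) summable_on UNIV"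
    by (rule summable_on_diff_right[OF jbr_powr_summable[OF assms(2)]])
  let ?g = "\<lambda>l. (2 powr p * wt \<beta> p (j - k)) * (?J (j - l) + ?J (l - k))"
  have g: "?g summable_on UNIV"
    by (intro summable_on_cmult_right summable_on_add s1 s2)
  have le: "wt \<beta> p (j - l) * wt \<beta> p (l - k) \<le> ?g l" for l
    using wt_mult_le[of \<beta> p "j - l" "l - k"] assms by (simp add: mult_ac)
  show s: "(\<lambda>l. wt \<beta> p (j - l) * wt \<beta> p (l - k)) summable_on UNIV"
    by (rule summable_on_comparison_test[OF g]) (auto intro: le)
  have "(\<Sum>\<^sub>\<infinity>l. wt \<beta> p (j - l) * wt \<beta> p (l - k)) \<le> infsum ?g UNIV"
    by (rule infsum_mono[OF s g le])
  also have "\<dots> = (2 powr p * wt \<beta> p (j - k)) * (infsum (\<lambda>l. ?J (j - l)) UNIV + infsum (\<lambda>l. ?J (l - k)) UNIV)"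
    by (simp only: infsum_cmult_right' infsum_add[OF s1 s2])
  also have "\<dots> = (2 powr p * wt \<beta> p (j - k)) * (jbr_zeta p + jbr_zeta p)"
    unfolding infsum_diff_left[of ?J] infsum_diff_right[of ?J] jbr_zeta_def ..
  also have "\<dots> = conv_const p * wt \<beta> p (j - k)"
    by (simp add: conv_const_def)
  finally show "(\<Sum>\<^sub>\<infinity>l. wt \<beta> p (j - l) * wt \<beta> p (l - k)) \<le> conv_const p * wt \<beta> p (j - k)" .
qed

subsection \<open>Primitives and oscillatory integrals\<close>

lemma norm_infsum_le:
  fixes f :: "'a \<Rightarrow> 'b::banach" and g :: "'a \<Rightarrow> real"
  assumes "g summable_on A" "\<And>x. x \<in> A \<Longrightarrow> norm (f x) \<le> g x"
  shows "f summable_on A" "norm (infsum f A) \<le> infsum g A"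
proof -
  have s: "f abs_summable_on A"
    by (rule Infinite_Sum.abs_summable_on_comparison_test'[OF assms])
  show "f summable_on A"
    by (rule abs_summable_summable[OF s])
  have "norm (infsum f A) \<le> infsum (\<lambda>x. norm (f x)) A"
    by (rule norm_infsum_bound[OF s])
  also have "\<dots> \<le> infsum g A"
    by (rule infsum_mono[OF s assms])
  finally show "norm (infsum f A) \<le> infsum g A" .
qed

text \<open>A mean value inequality with a variable majorant; the Picard iteration needs a bound
  that grows with time.\<close>

lemma norm_diff_le_of_derivative_le:
  fixes f :: "real \<Rightarrow> 'a::real_normed_vector"
  assumes f: "\<And>s. s \<in> {0..T} \<Longrightarrow> (f has_vector_derivative f' s) (at s within {0..T})"
    and g: "\<And>s. s \<in> {0..T} \<Longrightarrow> (g has_vector_derivative g' s) (at s within {0..T})"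
    and le: "\<And>s. s \<in> {0..T} \<Longrightarrow> norm (f' s) \<le> g' s"
    and t: "t \<in> {0..T}"
  shows "norm (f t - f 0) \<le> g t - g 0"
proof (cases "t = 0")
  case False
  then have t0: "0 < t" using t by simp
  have sub: "{0..t} \<subseteq> {0..T}" using t by auto
  have cf: "continuous_on {0..t} f"
    using f by (intro continuous_on_subset[OF _ sub] continuous_on_vector_derivative) auto
  have cg: "continuous_on {0..t} g"
    using g by (intro continuous_on_subset[OF _ sub] continuous_on_vector_derivative) auto
  have at: "at s within {0..T} = at s" if "0 < s" "s < t" for s
    using that t by (intro at_within_interior) (auto simp: interior_atLeastAtMost_real)
  show ?thesis
  proof (rule differentiable_bound_general[OF t0 cf cg, of f' g'])
    fix s assume s: "0 < s" "s < t"
    then have "s \<in> {0..T}" using t by auto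
    then show "(f has_vector_derivative f' s) (at s)" "(g has_vector_derivative g' s) (at s)"
      "norm (f' s) \<le> g' s"
      using f[of s] g[of s] le[of s] at[OF s] by auto
  qed
qed auto

lemma norm_le_of_derivative_le_const:
  fixes f :: "real \<Rightarrow> 'a::real_normed_vector"
  assumes "\<And>s. s \<in> {0..T} \<Longrightarrow> (f has_vector_derivative f' s) (at s within {0..T})"
    and "f 0 = 0"
    and "\<And>s. s \<in> {0..T} \<Longrightarrow> norm (f' s) \<le> M"
    and t: "t \<in> {0..T}"
  shows "norm (f t) \<le> T * M"
proof -
  have "norm (f t - f 0) \<le> t * M - 0 * M"
    by (rule norm_diff_le_of_derivative_le[where g = "\<lambda>s. s * M" and g' = "\<lambda>s. M", OF assms(1) _ assms(3) t])
      (auto intro!: derivative_eq_intros)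
  moreover have "0 \<le> M"
    using assms(3)[OF t] norm_ge_zero order_trans by blast
  then have "t * M \<le> T * M"
    using t by (intro mult_right_mono) auto
  ultimately show ?thesis
    using assms(2) by simp
qed

text \<open>Integration by parts writes F as B y minus a primitive of B y'. Only B has to be small,
  its derivative need not be; the two pieces contribute 1 and T.\<close>

lemma norm_primitive_mult_le:
  fixes B y F :: "real \<Rightarrow> complex"
  assumes B: "\<And>s. s \<in> {0..T} \<Longrightarrow> (B has_vector_derivative B' s) (at s within {0..T})" "B 0 = 0"
    and y: "\<And>s. s \<in> {0..T} \<Longrightarrow> (y has_vector_derivative y' s) (at s within {0..T})"
    and F: "\<And>s. s \<in> {0..T} \<Longrightarrow> (F has_vector_derivative B' s * y s) (at s within {0..T})" "F 0 = 0"
    and b: "\<And>s. s \<in> {0..T} \<Longrightarrow> cmod (B s) \<le> b"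
    and c: "\<And>s. s \<in> {0..T} \<Longrightarrow> cmod (y s) \<le> c" "\<And>s. s \<in> {0..T} \<Longrightarrow> cmod (y' s) \<le> c"
    and t: "t \<in> {0..T}"
  shows "cmod (F t) \<le> (1 + T) * (b * c)"
proof -
  define G where "G s = B s * y s - F s" for s
  have "cmod (G t) \<le> T * (b * c)"
  proof (rule norm_le_of_derivative_le_const[where T = T and f = G and f' = "\<lambda>s. B s * y' s"])
    fix s assume s: "s \<in> {0..T}"
    have "((\<lambda>s. B s * y s) has_vector_derivative B s * y' s + B' s * y s) (at s within {0..T})"
      by (rule has_vector_derivative_mult[OF B(1)[OF s] y[OF s]])
    from has_vector_derivative_diff[OF this F(1)[OF s]]
    show "(G has_vector_derivative B s * y' s) (at s within {0..T})"
      by (simp add: G_def[abs_def])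
    show "cmod (B s * y' s) \<le> b * c"
      unfolding norm_mult using b[OF s] c(2)[OF s] norm_ge_zero order_trans
      by (intro mult_mono) (blast intro: order_trans norm_ge_zero)+
  qed (use B F t in \<open>auto simp: G_def\<close>)
  moreover have "cmod (B t * y t) \<le> b * c"
    unfolding norm_mult using b[OF t] c(1)[OF t]
    by (intro mult_mono) (blast intro: order_trans norm_ge_zero)+
  moreover have "cmod (F t) \<le> cmod (B t * y t) + cmod (G t)"
    using norm_triangle_ineq4[of "B t * y t" "G t"] by (simp add: G_def)
  ultimately show ?thesis
    by (simp add: algebra_simps)
qed

lemma has_vector_derivative_cis_mult:
  "((\<lambda>s. cis (\<theta> * s)) has_vector_derivative \<i> * of_real \<theta> * cis (\<theta> * s)) (at s within S)"
proof -
  have "((\<lambda>s. cis (\<theta> * s)) has_derivative (\<lambda>t. (\<theta> * t) *\<^sub>R (\<i> * cis (\<theta> * s)))) (at s within S)"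
    by (auto intro!: derivative_eq_intros)
  then show ?thesis
    unfolding has_vector_derivative_def by (rule has_derivative_eq_rhs) (auto simp: scaleR_conv_of_real)
qed

text \<open>One integration by parts: the two boundary values contribute 2 and the integral of f'
  contributes T.\<close>

lemma norm_oscillatory_primitive_le:
  fixes f :: "real \<Rightarrow> complex"
  assumes f: "\<And>s. s \<in> {0..T} \<Longrightarrow> (f has_vector_derivative f' s) (at s within {0..T})"
    and F: "\<And>s. s \<in> {0..T} \<Longrightarrow> (F has_vector_derivative f s * cis (\<theta> * s)) (at s within {0..T})" "F 0 = 0"
    and b: "\<And>s. s \<in> {0..T} \<Longrightarrow> cmod (f s) \<le> A" "\<And>s. s \<in> {0..T} \<Longrightarrow> cmod (f' s) \<le> A"
    and \<theta>: "\<theta> \<noteq> 0" and t: "t \<in> {0..T}"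
  shows "cmod (F t) \<le> (2 + T) * A / \<bar>\<theta>\<bar>"
proof -
  define G where "G s = F s - (f s * cis (\<theta> * s) - f 0) / (\<i> * of_real \<theta>)" for s
  have "cmod (G t) \<le> T * (A / \<bar>\<theta>\<bar>)"
  proof (rule norm_le_of_derivative_le_const[where f = G and f' = "\<lambda>s. - (f' s * cis (\<theta> * s)) / (\<i> * of_real \<theta>)"])
    fix s assume s: "s \<in> {0..T}"
    have "((\<lambda>s. (f s * cis (\<theta> * s) - f 0) / (\<i> * of_real \<theta>)) has_vector_derivative
       (f s * (\<i> * of_real \<theta> * cis (\<theta> * s)) + f' s * cis (\<theta> * s)) / (\<i> * of_real \<theta>)) (at s within {0..T})"
      by (intro has_vector_derivative_divide has_vector_derivative_diff_const[THEN iffD2]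
          has_vector_derivative_mult f[OF s] has_vector_derivative_cis_mult)
    from has_vector_derivative_diff[OF F(1)[OF s] this]
    show "(G has_vector_derivative - (f' s * cis (\<theta> * s)) / (\<i> * of_real \<theta>)) (at s within {0..T})"
      using \<theta> by (simp add: G_def[abs_def] field_simps)
    show "cmod (- (f' s * cis (\<theta> * s)) / (\<i> * of_real \<theta>)) \<le> A / \<bar>\<theta>\<bar>"
      using b(2)[OF s] by (simp add: norm_mult norm_divide divide_right_mono)
  qed (use F t in \<open>auto simp: G_def\<close>)
  moreover have "cmod ((f t * cis (\<theta> * t) - f 0) / (\<i> * of_real \<theta>)) \<le> (A + A) / \<bar>\<theta>\<bar>"
  proof -
    have "cmod (f t * cis (\<theta> * t) - f 0) \<le> A + A"
      using norm_triangle_ineq4[of "f t * cis (\<theta> * t)" "f 0"] b(1)[OF t] b(1)[of 0] t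
      by (auto simp: norm_mult)
    then show ?thesis
      by (simp add: norm_mult norm_divide divide_right_mono)
  qed
  moreover have "cmod (F t) \<le> cmod (G t) + cmod ((f t * cis (\<theta> * t) - f 0) / (\<i> * of_real \<theta>))"
    using norm_triangle_ineq[of "G t" "(f t * cis (\<theta> * t) - f 0) / (\<i> * of_real \<theta>)"] by (simp add: G_def)
  ultimately show ?thesis
    by (simp add: algebra_simps add_divide_distrib)
qed

text \<open>Up to the factor -1 / (i \<theta>), the remainder is itself an oscillatory primitive, of
  f' instead of f. The one-step estimate applied to it gives the second power of \<theta>; this is
  where second derivatives in time enter.\<close>

lemma norm_oscillatory_primitive_remainder_le:
  fixes f :: "real \<Rightarrow> complex"
  assumes f: "\<And>s. s \<in> {0..T} \<Longrightarrow> (f has_vector_derivative f' s) (at s within {0..T})"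
    and f': "\<And>s. s \<in> {0..T} \<Longrightarrow> (f' has_vector_derivative f'' s) (at s within {0..T})"
    and F: "\<And>s. s \<in> {0..T} \<Longrightarrow> (F has_vector_derivative f s * cis (\<theta> * s)) (at s within {0..T})" "F 0 = 0"
    and b: "\<And>s. s \<in> {0..T} \<Longrightarrow> cmod (f' s) \<le> A" "\<And>s. s \<in> {0..T} \<Longrightarrow> cmod (f'' s) \<le> A"
    and \<theta>: "\<theta> \<noteq> 0" and t: "t \<in> {0..T}"
  shows "cmod (F t - (f t * cis (\<theta> * t) - f 0) / (\<i> * of_real \<theta>)) \<le> (2 + T) * A / \<theta>\<^sup>2"
proof -
  define G where "G s = f s * cis (\<theta> * s) - f 0 - \<i> * of_real \<theta> * F s" for s
  have "cmod (G t) \<le> (2 + T) * A / \<bar>\<theta>\<bar>"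
  proof (rule norm_oscillatory_primitive_le[OF f' _ _ b \<theta> t])
    fix s assume s: "s \<in> {0..T}"
    have "((\<lambda>s. f s * cis (\<theta> * s) - f 0) has_vector_derivative
       (f s * (\<i> * of_real \<theta> * cis (\<theta> * s)) + f' s * cis (\<theta> * s))) (at s within {0..T})"
      by (intro has_vector_derivative_diff_const[THEN iffD2]
          has_vector_derivative_mult f[OF s] has_vector_derivative_cis_mult)
    from has_vector_derivative_diff[OF this has_vector_derivative_mult_right[OF F(1)[OF s], of "\<i> * of_real \<theta>"]]
    show "(G has_vector_derivative f' s * cis (\<theta> * s)) (at s within {0..T})"
      by (simp add: G_def[abs_def] algebra_simps)
  qed (use F in \<open>auto simp: G_def\<close>)
  moreover have "F t - (f t * cis (\<theta> * t) - f 0) / (\<i> * of_real \<theta>) = - G t / (\<i> * of_real \<theta>)"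
    using \<theta> by (simp add: G_def field_simps)
  ultimately have "cmod (F t - (f t * cis (\<theta> * t) - f 0) / (\<i> * of_real \<theta>))
      \<le> ((2 + T) * A / \<bar>\<theta>\<bar>) / \<bar>\<theta>\<bar>"
    by (simp only: norm_divide norm_minus_cancel norm_mult norm_ii norm_of_real mult_1_left)
      (rule divide_right_mono, simp_all)
  then show ?thesis
    by (simp add: power2_eq_square flip: abs_mult)
qed

section \<open>Primitives and termwise integration of series\<close>

definition prim :: "(real \<Rightarrow> complex) \<Rightarrow> real \<Rightarrow> complex" where
  "prim f t = integral {0..t} f"

lemma prim_0 [simp]: "prim f 0 = 0"
  by (simp add: prim_def)

lemma prim_has_vector_derivative:
  assumes "continuous_on {0..T} f" "t \<in> {0..T}"
  shows "(prim f has_vector_derivative f t) (at t within {0..T})"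
  unfolding prim_def using integral_has_vector_derivative[OF assms] .

text \<open>The tails of the derivative series are bounded by tails of \<open>m\<close> uniformly in
  time. A finite partial sum therefore differs from y by at most T times a tail of \<open>m\<close>,
  and no exchange of sum and integral is needed.\<close>

lemma has_sum_of_derivative_infsum:
  fixes H g :: "'i \<Rightarrow> real \<Rightarrow> complex"
  assumes H: "\<And>l s. s \<in> {0..T} \<Longrightarrow> (H l has_vector_derivative g l s) (at s within {0..T})" "\<And>l. H l 0 = 0"
    and y: "\<And>s. s \<in> {0..T} \<Longrightarrow> (y has_vector_derivative (\<Sum>\<^sub>\<infinity>l. g l s)) (at s within {0..T})" "y 0 = 0"
    and m: "\<And>l s. s \<in> {0..T} \<Longrightarrow> cmod (g l s) \<le> m l" "m summable_on UNIV"
    and t: "t \<in> {0..T}"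
  shows "((\<lambda>l. H l t) has_sum y t) UNIV"
proof -
  let ?F = "finite_subsets_at_top (UNIV :: 'i set)"
  have bound: "cmod (sum (\<lambda>l. H l t) X - y t) \<le> T * (infsum m UNIV - sum m X)" if X: "finite X" for X
  proof (rule norm_le_of_derivative_le_const[where f = "\<lambda>t. sum (\<lambda>l. H l t) X - y t", OF _ _ _ t])
    fix s assume s: "s \<in> {0..T}"
    show "((\<lambda>t. sum (\<lambda>l. H l t) X - y t) has_vector_derivative
        sum (\<lambda>l. g l s) X - (\<Sum>\<^sub>\<infinity>l. g l s)) (at s within {0..T})"
      by (intro has_vector_derivative_diff has_vector_derivative_sum H y s)
    have "(\<lambda>l. g l s) summable_on UNIV"
      by (rule norm_infsum_le(1)[OF m(2)]) (use m s in auto)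
    then have "(\<Sum>\<^sub>\<infinity>l. g l s) - sum (\<lambda>l. g l s) X = infsum (\<lambda>l. g l s) (UNIV - X)"
      using X by (subst infsum_Diff) auto
    moreover have "cmod (infsum (\<lambda>l. g l s) (UNIV - X)) \<le> infsum m (UNIV - X)"
      by (rule norm_infsum_le(2)) (use m s in \<open>auto intro: summable_on_subset_banach\<close>)
    moreover have "infsum m (UNIV - X) = infsum m UNIV - sum m X"
      using X m by (subst infsum_Diff) auto
    ultimately show "cmod (sum (\<lambda>l. g l s) X - (\<Sum>\<^sub>\<infinity>l. g l s)) \<le> infsum m UNIV - sum m X"
      by (metis norm_minus_commute)
  qed (use H y in auto)
  have "((\<lambda>X. T * (infsum m UNIV - sum m X)) \<longlongrightarrow> T * (infsum m UNIV - infsum m UNIV)) ?F"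
    by (intro tendsto_intros) (use m in \<open>simp add: has_sum_infsum flip: has_sum_def\<close>)
  then have "((\<lambda>X. T * (infsum m UNIV - sum m X)) \<longlongrightarrow> 0) ?F"
    by simp
  then have "((\<lambda>X. sum (\<lambda>l. H l t) X - y t) \<longlongrightarrow> 0) ?F"
    by (rule Lim_null_comparison[rotated])
      (auto intro!: eventually_finite_subsets_at_top_weakI bound)
  then show ?thesis
    unfolding has_sum_def by (simp add: LIM_zero_iff)
qed

subsection \<open>Dyson terms of a smooth potential\<close>

locale smooth_potential =
  fixes h \<alpha> \<beta> c :: real and v v' v'' :: "int \<Rightarrow> real \<Rightarrow> complex"
  assumes h_pos: "h > 0" and \<alpha>_gt: "\<alpha> > 2" and c_pos: "c > 0" and \<beta>_nonneg: "\<beta> \<ge> 0"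
    and v_zero: "v 0 t = 0"
    and v_periodic: "v n (t + 2 * pi) = v n t"
    and v_deriv: "(v n has_vector_derivative v' n t) (at t within S)"
    and v'_deriv: "(v' n has_vector_derivative v'' n t) (at t within S)"
    and v_le: "cmod (v n t) \<le> c * wt \<beta> \<alpha> n"
    and v'_le: "cmod (v' n t) \<le> c * wt \<beta> \<alpha> n"
    and v''_le: "cmod (v'' n t) \<le> c * wt \<beta> \<alpha> n"
begin

abbreviation w :: "int \<Rightarrow> real" where "w \<equiv> wt \<beta> \<alpha>"
abbreviation w1 :: "int \<Rightarrow> real" where "w1 \<equiv> wt \<beta> (\<alpha> - 1)"

definition \<kappa> :: real where "\<kappa> = c / h"
text \<open>The constant of \<open>B_le\<close>: the summand 2c = 2 \<kappa> h serves the
  oscillating entries, \<kappa> those with j^2 = l^2.\<close>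

definition b :: real where "b = (2 + 2 * pi) * (2 * c + \<kappa>)"
abbreviation D :: real where "D \<equiv> conv_const (\<alpha> - 1)"
abbreviation Z :: real where "Z \<equiv> jbr_zeta (\<alpha> - 1)"

text \<open>The target for a single path from k through l to j: one weight per hop and one gain at
  each end. By \<open>wt_convolution\<close> its sum over l has the size claimed for the
  remainder.\<close>

definition q :: "int \<Rightarrow> int \<Rightarrow> int \<Rightarrow> real" where
  "q j l k = w1 (j - l) * w1 (l - k) / (jbr j * jbr k)"

definition freq :: "int \<Rightarrow> int \<Rightarrow> real" where
  "freq j l = of_int (j\<^sup>2 - l\<^sup>2) / h"

definition f :: "int \<Rightarrow> real \<Rightarrow> complex" where
  "f n s = v n s / (\<i> * of_real h)"

definition a :: "int \<Rightarrow> int \<Rightarrow> real \<Rightarrow> complex" where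
  "a j l s = f (j - l) s * cis (freq j l * s)"

definition B :: "int \<Rightarrow> int \<Rightarrow> real \<Rightarrow> complex" where
  "B j l = prim (a j l)"

text \<open>The second-order term is bounded case by case: \<open>K1\<close> for l^2 = k^2,
  \<open>K2\<close> for replacing \<open>Tm\<close> by \<open>N\<close>, \<open>K3\<close> for
  \<open>N\<close> with an oscillating residual phase, \<open>K4\<close> for \<open>N\<close>
  without one.\<close>

definition K1 :: real where "K1 = (1 + 2 * pi)\<^sup>2 * \<kappa> * b"
definition K2 :: real where "K2 = 8 * pi * (2 + 2 * pi) * c\<^sup>2 + 2 * b * c"
definition K3 :: real where "K3 = 8 * (2 + 2 * pi) * c\<^sup>2"
definition K4 :: real where "K4 = 4 * pi * \<kappa> * c"

lemma \<kappa>_pos: "\<kappa> > 0"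
  using h_pos c_pos by (simp add: \<kappa>_def)

lemma \<kappa>_h [simp]: "\<kappa> * h = c"
  using h_pos by (simp add: \<kappa>_def)

lemma b_pos: "b > 0"
  using c_pos \<kappa>_pos by (simp add: b_def add_pos_pos)

lemma K_nonneg: "K1 \<ge> 0" "K2 \<ge> 0" "K3 \<ge> 0" "K4 \<ge> 0"
  using \<kappa>_pos b_pos c_pos by (simp_all add: K1_def K2_def K3_def K4_def)

lemma q_nonneg [simp]: "q j l k \<ge> 0"
  by (simp add: q_def)

lemma w1_eq: "w1 n = w n * jbr n"
  by (rule wt_shift)

lemma w_eq: "w n = w1 n / jbr n"
  by (simp add: w1_eq)

lemma w_le_w1: "w n \<le> w1 n"
  using mult_left_mono[OF jbr_ge_1, of "w n" n] by (simp add: w1_eq)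

text \<open>Peetre's inequality: one power of \<open>jbr (j - l)\<close> is spent to move the gain
  from l to j.\<close>

lemma w_div_le: "w (j - l) / jbr l \<le> w1 (j - l) / jbr j"
proof -
  have "w (j - l) * jbr j \<le> w (j - l) * (jbr l * jbr (j - l))"
    by (intro mult_left_mono jbr_le_mult_diff) simp
  then show ?thesis
    by (simp add: w1_eq field_simps)
qed

lemma w1_summable: "w1 summable_on UNIV"
  using \<alpha>_gt \<beta>_nonneg by (intro wt_summable) auto

lemma f_deriv: "(f n has_vector_derivative v' n t / (\<i> * of_real h)) (at t within S)"
  unfolding f_def[abs_def] by (intro has_vector_derivative_divide v_deriv)

lemma f'_deriv:
  "((\<lambda>t. v' n t / (\<i> * of_real h)) has_vector_derivative v'' n t / (\<i> * of_real h)) (at t within S)"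
  by (intro has_vector_derivative_divide v'_deriv)

lemma f_le:
  "cmod (f n t) \<le> \<kappa> * w n" "cmod (v' n t / (\<i> * of_real h)) \<le> \<kappa> * w n"
  "cmod (v'' n t / (\<i> * of_real h)) \<le> \<kappa> * w n"
  using v_le[of n t] v'_le[of n t] v''_le[of n t] h_pos
  by (simp_all add: f_def norm_divide norm_mult \<kappa>_def divide_right_mono)

lemma continuous_on_f [continuous_intros]: "continuous_on S (f n)"
  by (rule continuous_on_vector_derivative) (rule f_deriv)

lemma continuous_on_cis_mult [continuous_intros]: "continuous_on S (\<lambda>s. cis (\<theta> * s))"
  by (rule continuous_on_vector_derivative) (rule has_vector_derivative_cis_mult)

lemma continuous_on_a [continuous_intros]: "continuous_on S (a j l)"
  unfolding a_def[abs_def] by (intro continuous_intros)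

lemma a_le: "cmod (a j l s) \<le> \<kappa> * w (j - l)"
  using f_le(1)[of "j - l" s] by (simp add: a_def norm_mult)

lemma a_le_w1: "cmod (a j l s) \<le> \<kappa> * w1 (j - l)"
  by (rule order_trans[OF a_le]) (use \<kappa>_pos w_le_w1 in \<open>auto intro: mult_left_mono\<close>)

lemma a_diag [simp]: "a j j s = 0"
  by (simp add: a_def f_def v_zero)

text \<open>On the antidiagonal the weight itself supplies a factor \<open>1 / jbr j\<close>.\<close>
lemma a_le_of_eq_squares:
  assumes "j\<^sup>2 = l\<^sup>2"
  shows "cmod (a j l s) \<le> \<kappa> * w1 (j - l) / jbr j"
proof (cases "l = j")
  case False
  then have l: "l = - j"
    using assms by (auto simp: power2_eq_iff)
  have "jbr j \<le> jbr (j - l)"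
    unfolding l by (intro jbr_mono) simp
  then have "w (j - l) \<le> w1 (j - l) / jbr j"
    unfolding w_eq by (intro divide_left_mono) auto
  then have "\<kappa> * w (j - l) \<le> \<kappa> * (w1 (j - l) / jbr j)"
    using \<kappa>_pos by (intro mult_left_mono) auto
  then show ?thesis
    using a_le[of j l s] by simp
qed (use \<kappa>_pos in simp)

lemma freq_eq_0_iff: "freq j l = 0 \<longleftrightarrow> j\<^sup>2 = l\<^sup>2"
proof -
  have "freq j l = 0 \<longleftrightarrow> real_of_int (j\<^sup>2 - l\<^sup>2) = 0"
    using h_pos by (simp add: freq_def)
  also have "\<dots> \<longleftrightarrow> j\<^sup>2 = l\<^sup>2"
    unfolding of_int_eq_0_iff by simp
  finally show ?thesis .
qed

text \<open>The disjunction lets each use choose which of the two modes receives the gain.\<close>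

lemma inverse_freq_le:
  assumes "j\<^sup>2 \<noteq> l\<^sup>2" and x: "x = jbr j \<or> x = jbr l"
  shows "1 / \<bar>freq j l\<bar> \<le> 2 * h / x"
proof -
  let ?n = "\<bar>real_of_int (j\<^sup>2 - l\<^sup>2)\<bar>"
  have "x \<le> 2 * ?n"
    using jbr_le_square_diff[OF assms(1)] x by auto
  moreover have "?n > 0"
    by (rule square_diff_pos[OF assms(1)])
  moreover have "x > 0"
    using x by auto
  ultimately have "h / ?n \<le> 2 * h / x"
    using h_pos by (simp add: field_simps)
  then show ?thesis
    using h_pos by (simp add: freq_def)
qed

lemma B_deriv: "t \<in> {0..2*pi} \<Longrightarrow> (B j l has_vector_derivative a j l t) (at t within {0..2*pi})"
  unfolding B_def by (intro prim_has_vector_derivative continuous_intros)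

lemma B_0 [simp]: "B j l 0 = 0"
  by (simp add: B_def)

lemma continuous_on_B: "continuous_on {0..2*pi} (B j l)"
  by (rule continuous_on_vector_derivative) (rule B_deriv)

text \<open>Off resonance, one integration by parts supplies the gain. On resonance |j| = |l|, so
  both choices of x agree and \<open>a_le_of_eq_squares\<close> supplies it.\<close>

lemma B_le:
  assumes t: "t \<in> {0..2*pi}" and x: "x = jbr j \<or> x = jbr l"
  shows "cmod (B j l t) \<le> b * w1 (j - l) / x"
proof -
  have x0: "x > 0" using x by auto
  show ?thesis
  proof (cases "j\<^sup>2 = l\<^sup>2")
    case True
    then have "\<bar>j\<bar> = \<bar>l\<bar>"
      by (simp add: power2_eq_iff abs_eq_iff)
    then have xj: "x = jbr j"
      using x by (auto simp: jbr_def)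
    have "cmod (B j l t) \<le> 2 * pi * (\<kappa> * w1 (j - l) / jbr j)"
      by (rule norm_le_of_derivative_le_const[OF B_deriv _ a_le_of_eq_squares[OF True] t]) auto
    also have "\<dots> = (2 * pi * \<kappa>) * (w1 (j - l) / jbr j)"
      by simp
    also have "\<dots> \<le> b * (w1 (j - l) / jbr j)"
      using c_pos \<kappa>_pos by (intro mult_right_mono) (auto simp: b_def algebra_simps intro: add_nonneg_nonneg)
    finally show ?thesis
      by (simp add: xj)
  next
    case False
    have "cmod (B j l t) \<le> (2 + 2 * pi) * (\<kappa> * w (j - l)) / \<bar>freq j l\<bar>"
    proof (rule norm_oscillatory_primitive_le[OF f_deriv])
      show "(B j l has_vector_derivative f (j - l) s * cis (freq j l * s)) (at s within {0..2*pi})"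
        if "s \<in> {0..2*pi}" for s
        using B_deriv[OF that] by (simp add: a_def)
    qed (use False f_le t in \<open>auto simp: freq_eq_0_iff\<close>)
    also have "\<dots> = ((2 + 2 * pi) * (\<kappa> * w (j - l))) * (1 / \<bar>freq j l\<bar>)"
      by simp
    also have "\<dots> \<le> ((2 + 2 * pi) * (\<kappa> * w1 (j - l))) * (2 * h / x)"
      using inverse_freq_le[OF False x] \<kappa>_pos w_le_w1 by (intro mult_mono) auto
    also have "\<dots> = ((2 + 2 * pi) * (2 * (\<kappa> * h))) * (w1 (j - l) / x)"
      by simp
    also have "\<dots> \<le> b * (w1 (j - l) / x)"
      using x0 \<kappa>_pos unfolding b_def \<kappa>_h by (intro mult_right_mono mult_left_mono) auto
    finally show ?thesis
      by simp
  qed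
qed

text \<open>The second Dyson term, split over the intermediate mode \<open>l\<close>, and its resonant part \<open>N\<close>.\<close>
definition Tm :: "int \<Rightarrow> int \<Rightarrow> int \<Rightarrow> real \<Rightarrow> complex" where
  "Tm j l k = prim (\<lambda>s. a j l s * B l k s)"

text \<open>The amplitude left when \<open>B l k\<close> is replaced by its boundary term at time s.
  The phases of the two hops add up to \<open>freq j k\<close>, which is why \<open>N\<close>
  carries that frequency.\<close>

definition Nd :: "int \<Rightarrow> int \<Rightarrow> int \<Rightarrow> real \<Rightarrow> complex" where
  "Nd j l k s = f (j - l) s * f (l - k) s / (\<i> * of_real (freq l k))"

definition N :: "int \<Rightarrow> int \<Rightarrow> int \<Rightarrow> real \<Rightarrow> complex" where
  "N j l k = prim (\<lambda>s. Nd j l k s * cis (freq j k * s))"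

lemma Tm_deriv:
  "t \<in> {0..2*pi} \<Longrightarrow> (Tm j l k has_vector_derivative a j l t * B l k t) (at t within {0..2*pi})"
  unfolding Tm_def by (intro prim_has_vector_derivative continuous_intros continuous_on_B)

lemma Tm_0 [simp]: "Tm j l k 0 = 0"
  by (simp add: Tm_def)

lemma Nd_deriv:
  "(Nd j l k has_vector_derivative
     (f (j - l) s * (v' (l - k) s / (\<i> * of_real h)) + (v' (j - l) s / (\<i> * of_real h)) * f (l - k) s)
       / (\<i> * of_real (freq l k))) (at s within S)"
  unfolding Nd_def[abs_def]
  by (intro has_vector_derivative_divide has_vector_derivative_mult f_deriv)

lemma N_deriv:
  "t \<in> {0..2*pi} \<Longrightarrow>
    (N j l k has_vector_derivative Nd j l k t * cis (freq j k * t)) (at t within {0..2*pi})"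
proof -
  have "continuous_on {0..2*pi} (Nd j l k)"
    by (rule continuous_on_vector_derivative) (rule Nd_deriv)
  then show "t \<in> {0..2*pi} \<Longrightarrow> ?thesis"
    unfolding N_def by (intro prim_has_vector_derivative continuous_intros)
qed

lemma N_0 [simp]: "N j l k 0 = 0"
  by (simp add: N_def)

text \<open>Here \<open>a l k\<close> is already of order 1 / \<open>jbr k\<close>, and so is
  \<open>B l k\<close>. Integrating the other factor by parts puts the gain of \<open>B j l\<close>
  at the end j.\<close>

lemma Tm_le_of_eq_right:
  assumes eq: "l\<^sup>2 = k\<^sup>2" and t: "t \<in> {0..2*pi}"
  shows "cmod (Tm j l k t) \<le> K1 * q j l k"
proof -
  define e where "e = \<kappa> * w1 (l - k) / jbr k"
  have e0: "e \<ge> 0" using \<kappa>_pos by (simp add: e_def)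
  have "\<bar>l\<bar> = \<bar>k\<bar>"
    using eq by (simp add: power2_eq_iff abs_eq_iff)
  then have "jbr l = jbr k" by (simp add: jbr_def)
  then have al: "cmod (a l k s) \<le> e" for s
    using a_le_of_eq_squares[OF eq, of s] by (simp add: e_def)
  have Bl: "cmod (B l k s) \<le> 2 * pi * e" if "s \<in> {0..2*pi}" for s
    by (rule norm_le_of_derivative_le_const[OF B_deriv _ al that]) auto
  have "cmod (Tm j l k t) \<le> (1 + 2 * pi) * ((b * w1 (j - l) / jbr j) * ((1 + 2 * pi) * e))"
  proof (rule norm_primitive_mult_le[OF B_deriv _ B_deriv Tm_deriv])
    show "cmod (B l k s) \<le> (1 + 2 * pi) * e" if "s \<in> {0..2*pi}" for s
      using Bl[OF that] e0 by (simp add: algebra_simps)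
    show "cmod (a l k s) \<le> (1 + 2 * pi) * e" for s
      using al[of s] e0 by (simp add: algebra_simps add_increasing2)
  qed (use t in \<open>auto intro!: B_le\<close>)
  then show ?thesis
    by (simp add: K1_def q_def e_def power2_eq_square mult_ac)
qed

text \<open>Two integrations by parts split \<open>B l k\<close> into a boundary term at s, one at 0
  and a remainder \<rho> of order 1 / \<theta>^2. The first produces \<open>N\<close>, the second a
  small multiple of \<open>B j l\<close>, and \<open>X\<close> isolates the contribution of
  \<rho>.\<close>

lemma Tm_minus_N_le:
  assumes ne: "l\<^sup>2 \<noteq> k\<^sup>2" and t: "t \<in> {0..2*pi}"
  shows "cmod (Tm j l k t - N j l k t) \<le> K2 * q j l k"
proof -
  define \<theta> where "\<theta> = freq l k"
  have \<theta>0: "\<theta> \<noteq> 0" using ne by (simp add: \<theta>_def freq_eq_0_iff)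
  define \<rho> where "\<rho> s = B l k s - (f (l - k) s * cis (\<theta> * s) - f (l - k) 0) / (\<i> * of_real \<theta>)" for s
  define X where "X s = Tm j l k s - N j l k s + f (l - k) 0 / (\<i> * of_real \<theta>) * B j l s" for s
  have inv: "1 / \<bar>\<theta>\<bar> \<le> 2 * h / jbr l" "1 / \<bar>\<theta>\<bar> \<le> 2 * h / jbr k"
    unfolding \<theta>_def using inverse_freq_le[OF ne] by auto
  have \<rho>_le: "cmod (\<rho> s) \<le> (2 + 2 * pi) * (\<kappa> * w (l - k)) / \<theta>\<^sup>2" if "s \<in> {0..2*pi}" for s
    unfolding \<rho>_def
  proof (rule norm_oscillatory_primitive_remainder_le[OF f_deriv f'_deriv])
    show "(B l k has_vector_derivative f (l - k) s * cis (\<theta> * s)) (at s within {0..2*pi})"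
      if "s \<in> {0..2*pi}" for s
      using B_deriv[OF that] by (simp add: a_def \<theta>_def)
  qed (use \<theta>0 f_le that in auto)
  have "cmod (X t) \<le> 2 * pi * ((\<kappa> * w (j - l)) * ((2 + 2 * pi) * (\<kappa> * w (l - k)) / \<theta>\<^sup>2))"
  proof (rule norm_le_of_derivative_le_const[where f' = "\<lambda>s. a j l s * \<rho> s", OF _ _ _ t])
    fix s assume s: "s \<in> {0..2*pi}"
    have "a j l s * B l k s - Nd j l k s * cis (freq j k * s) + f (l - k) 0 / (\<i> * of_real \<theta>) * a j l s
        = a j l s * \<rho> s"
    proof -
      have "cis (freq j k * s) = cis (freq j l * s) * cis (\<theta> * s)"
        by (simp add: \<theta>_def freq_def cis_mult diff_divide_distrib algebra_simps)
      then show ?thesis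
        using \<theta>0 by (simp add: \<rho>_def Nd_def a_def \<theta>_def[symmetric] field_simps)
    qed
    moreover have "(X has_vector_derivative a j l s * B l k s - Nd j l k s * cis (freq j k * s)
        + f (l - k) 0 / (\<i> * of_real \<theta>) * a j l s) (at s within {0..2*pi})"
      unfolding X_def[abs_def]
      by (intro has_vector_derivative_add has_vector_derivative_diff Tm_deriv N_deriv
          has_vector_derivative_mult_right B_deriv s)
    ultimately show "(X has_vector_derivative a j l s * \<rho> s) (at s within {0..2*pi})"
      by simp
    show "cmod (a j l s * \<rho> s) \<le> (\<kappa> * w (j - l)) * ((2 + 2 * pi) * (\<kappa> * w (l - k)) / \<theta>\<^sup>2)"
      unfolding norm_mult using \<kappa>_pos by (intro mult_mono a_le \<rho>_le s) auto
  qed (simp add: X_def)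
  also have "\<dots> = (2 * pi * (2 + 2 * pi) * \<kappa>\<^sup>2 * w (j - l) * w (l - k)) * ((1 / \<bar>\<theta>\<bar>) * (1 / \<bar>\<theta>\<bar>))"
    by (simp add: power2_eq_square)
  \<comment> \<open>One factor 1 / |\<theta>| is converted at k, the other at l. The weight
    \<open>w (j - l)\<close> is kept so that \<open>w_div_le\<close> can next move the gain from l
    to j.\<close>
  also have "\<dots> \<le> (2 * pi * (2 + 2 * pi) * \<kappa>\<^sup>2 * w (j - l) * w1 (l - k)) * ((2 * h / jbr l) * (2 * h / jbr k))"
    using inv h_pos w_le_w1 by (intro mult_mono) auto
  also have "\<dots> = (8 * pi * (2 + 2 * pi) * c\<^sup>2 * w1 (l - k) / jbr k) * (w (j - l) / jbr l)"
    using h_pos by (simp add: \<kappa>_def power2_eq_square field_simps)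
  also have "\<dots> \<le> (8 * pi * (2 + 2 * pi) * c\<^sup>2 * w1 (l - k) / jbr k) * (w1 (j - l) / jbr j)"
    by (intro mult_left_mono w_div_le) auto
  also have "\<dots> = (8 * pi * (2 + 2 * pi) * c\<^sup>2) * q j l k"
    by (simp add: q_def mult_ac)
  finally have 1: "cmod (X t) \<le> (8 * pi * (2 + 2 * pi) * c\<^sup>2) * q j l k" .
  have "cmod (f (l - k) 0 / (\<i> * of_real \<theta>) * B j l t) = cmod (f (l - k) 0) * (1 / \<bar>\<theta>\<bar>) * cmod (B j l t)"
    by (simp add: norm_mult norm_divide)
  also have "\<dots> \<le> (\<kappa> * w1 (l - k)) * (2 * h / jbr k) * (b * w1 (j - l) / jbr j)"
    using inv(2) h_pos b_pos \<kappa>_pos t w_le_w1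
    by (intro mult_mono B_le order_trans[OF f_le(1)]) auto
  also have "\<dots> = (2 * b * c) * q j l k"
    using h_pos by (simp add: q_def \<kappa>_def field_simps)
  finally have 2: "cmod (f (l - k) 0 / (\<i> * of_real \<theta>) * B j l t) \<le> 2 * b * c * q j l k"
    by simp
  have "Tm j l k t - N j l k t = X t - f (l - k) 0 / (\<i> * of_real \<theta>) * B j l t"
    by (simp add: X_def)
  then have "cmod (Tm j l k t - N j l k t) \<le> cmod (X t) + cmod (f (l - k) 0 / (\<i> * of_real \<theta>) * B j l t)"
    by (simp only: norm_triangle_ineq4)
  then show ?thesis
    using 1 2 by (simp add: K2_def distrib_right)
qed

text \<open>The denominator \<open>freq l k\<close> supplies the gain at k; integrating the residual
  phase \<open>freq j k\<close> by parts supplies the one at j.\<close>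

lemma N_le_of_neq:
  assumes ne: "l\<^sup>2 \<noteq> k\<^sup>2" and jk: "j\<^sup>2 \<noteq> k\<^sup>2" and t: "t \<in> {0..2*pi}"
  shows "cmod (N j l k t) \<le> K3 * q j l k"
proof -
  define A where "A = 2 * (\<kappa> * w (j - l)) * (\<kappa> * w (l - k)) * (2 * h / jbr k)"
  define E where "E = (\<kappa> * w (j - l)) * (\<kappa> * w (l - k))"
  have E0: "E \<ge> 0" using \<kappa>_pos by (simp add: E_def)
  have inv: "1 / \<bar>freq l k\<bar> \<le> 2 * h / jbr k"
    using inverse_freq_le[OF ne] by auto
  have div: "cmod (x / (\<i> * of_real (freq l k))) \<le> A" if "cmod x \<le> 2 * E" for x
  proof -
    have "cmod (x / (\<i> * of_real (freq l k))) = cmod x * (1 / \<bar>freq l k\<bar>)"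
      by (simp add: norm_divide norm_mult)
    also have "\<dots> \<le> (2 * E) * (2 * h / jbr k)"
      using that inv E0 by (intro mult_mono) auto
    finally show ?thesis
      by (simp add: A_def E_def mult_ac)
  qed
  have ff: "cmod (f (j - l) s * f (l - k) s) \<le> E"
    "cmod (f (j - l) s * (v' (l - k) s / (\<i> * of_real h))) \<le> E"
    "cmod ((v' (j - l) s / (\<i> * of_real h)) * f (l - k) s) \<le> E" for s
    unfolding E_def norm_mult[of "f _ _"] norm_mult[of "v' _ _ / _"]
    using \<kappa>_pos by (intro mult_mono f_le; simp)+
  have "cmod (N j l k t) \<le> (2 + 2 * pi) * A / \<bar>freq j k\<bar>"
  proof (rule norm_oscillatory_primitive_le[OF Nd_deriv N_deriv])
    show "cmod (Nd j l k s) \<le> A" for s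
      unfolding Nd_def using ff(1)[of s] E0 by (intro div) auto
    show "cmod ((f (j - l) s * (v' (l - k) s / (\<i> * of_real h)) + (v' (j - l) s / (\<i> * of_real h)) * f (l - k) s)
       / (\<i> * of_real (freq l k))) \<le> A" for s
      by (intro div order_trans[OF norm_triangle_ineq]) (use ff(2,3)[of s] in linarith)
  qed (use jk t in \<open>auto simp: freq_eq_0_iff\<close>)
  also have "\<dots> = ((2 + 2 * pi) * A) * (1 / \<bar>freq j k\<bar>)"
    by simp
  also have "\<dots> \<le> ((2 + 2 * pi) * A) * (2 * h / jbr j)"
    using inverse_freq_le[OF jk] h_pos \<kappa>_pos by (intro mult_left_mono) (auto simp: A_def)
  also have "\<dots> = (8 * (2 + 2 * pi) * c\<^sup>2) * (w (j - l) * w (l - k) / (jbr j * jbr k))"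
    using h_pos by (simp add: A_def \<kappa>_def power2_eq_square field_simps)
  also have "\<dots> \<le> (8 * (2 + 2 * pi) * c\<^sup>2) * q j l k"
    unfolding q_def by (intro mult_left_mono divide_right_mono mult_mono w_le_w1) auto
  finally show ?thesis
    unfolding K3_def .
qed

text \<open>No oscillation is used. The two powers by which \<open>w\<close> beats \<open>w1\<close>
  on the hops, together with the denominator, must pay for both gains, and \<open>large\<close> says
  that they do.\<close>

lemma N_le_of_large:
  assumes ne: "l\<^sup>2 \<noteq> k\<^sup>2" and t: "t \<in> {0..2*pi}"
    and large: "jbr j * jbr k \<le> 2 * \<bar>real_of_int (l\<^sup>2 - k\<^sup>2)\<bar> * (jbr (j - l) * jbr (l - k))"
  shows "cmod (N j l k t) \<le> K4 * q j l k"
proof -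
  let ?d = "\<bar>real_of_int (l\<^sup>2 - k\<^sup>2)\<bar>"
  have d: "?d > 0"
    by (rule square_diff_pos[OF ne])
  have fr: "1 / \<bar>freq l k\<bar> = h / ?d"
    using h_pos by (simp add: freq_def)
  have "cmod (N j l k t) \<le> 2 * pi * ((\<kappa> * w (j - l)) * (\<kappa> * w (l - k)) * (h / ?d))"
  proof (rule norm_le_of_derivative_le_const[OF N_deriv _ _ t])
    fix s :: real
    have "cmod (Nd j l k s * cis (freq j k * s)) = cmod (f (j - l) s) * cmod (f (l - k) s) * (1 / \<bar>freq l k\<bar>)"
      by (simp add: Nd_def norm_mult norm_divide)
    also have "\<dots> \<le> (\<kappa> * w (j - l)) * (\<kappa> * w (l - k)) * (h / ?d)"
      unfolding fr using \<kappa>_pos h_pos by (intro mult_right_mono mult_mono f_le) auto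
    finally show "cmod (Nd j l k s * cis (freq j k * s)) \<le> (\<kappa> * w (j - l)) * (\<kappa> * w (l - k)) * (h / ?d)" .
  qed auto
  also have "\<dots> = (2 * pi * \<kappa> * c * (w1 (j - l) * w1 (l - k))) * (1 / (?d * (jbr (j - l) * jbr (l - k))))"
    using h_pos d by (simp add: w_eq \<kappa>_def field_simps)
  also have "\<dots> \<le> (2 * pi * \<kappa> * c * (w1 (j - l) * w1 (l - k))) * (2 / (jbr j * jbr k))"
  proof (rule mult_left_mono)
    have "jbr j * jbr k > 0" "?d * (jbr (j - l) * jbr (l - k)) > 0"
      using d by simp_all
    then show "1 / (?d * (jbr (j - l) * jbr (l - k))) \<le> 2 / (jbr j * jbr k)"
      using large by (simp add: divide_le_eq le_divide_eq mult_ac)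
  qed (use \<kappa>_pos c_pos in auto)
  also have "\<dots> = K4 * q j l k"
    by (simp add: q_def K4_def)
  finally show ?thesis .
qed

text \<open>Modes \<open>l = k + m\<close> and \<open>l = k - m\<close> cancel to leading order, since
  \<open>1 / (m (m + 2 k)) + 1 / (m (m - 2 k)) = 2 / (m\<^sup>2 - 4 k\<^sup>2)\<close>.\<close>
lemma N_reflect_le:
  assumes l: "l \<noteq> k" "\<bar>l - k\<bar> < \<bar>k\<bar>" and t: "t \<in> {0..2*pi}"
  shows "cmod (N k l k t + N k (2 * k - l) k t) \<le> 4 * K4 * q k l k"
proof -
  define m where "m = l - k"
  have lm: "l = k + m" by (simp add: m_def)
  have m: "m \<noteq> 0" "\<bar>m\<bar> < \<bar>k\<bar>" using l by (auto simp: m_def)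
  have m2: "m\<^sup>2 < k\<^sup>2"
    using m(2) by (metis abs_le_square_iff not_le)
  have k0: "\<bar>k\<bar> \<ge> 1" using m by linarith
  have den: "real_of_int ((2 * k - l)\<^sup>2 - k\<^sup>2) = real_of_int m * (real_of_int m - 2 * real_of_int k)"
    "real_of_int (l\<^sup>2 - k\<^sup>2) = real_of_int m * (real_of_int m + 2 * real_of_int k)"
    by (simp_all add: lm power2_eq_square algebra_simps)
  have nz: "real_of_int m \<noteq> 0" "real_of_int m - 2 * real_of_int k \<noteq> 0" "real_of_int m + 2 * real_of_int k \<noteq> 0"
  proof -
    have "m - 2 * k \<noteq> 0" "m + 2 * k \<noteq> 0" using m by auto
    then have "real_of_int (m - 2 * k) \<noteq> 0" "real_of_int (m + 2 * k) \<noteq> 0"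
      by (simp_all only: of_int_eq_0_iff not_False_eq_True)
    then show "real_of_int m \<noteq> 0" "real_of_int m - 2 * real_of_int k \<noteq> 0" "real_of_int m + 2 * real_of_int k \<noteq> 0"
      using m by simp_all
  qed
  define r where "r = 2 * h / (real_of_int (m\<^sup>2) - 4 * real_of_int (k\<^sup>2))"
  have inv: "1 / freq l k + 1 / freq (2 * k - l) k = r"
  proof -
    have "1 / (x * (x + y)) + 1 / (x * (x - y)) = 2 / (x\<^sup>2 - y\<^sup>2)"
      if "x \<noteq> 0" "x - y \<noteq> 0" "x + y \<noteq> 0" for x y :: real
    proof -
      have "x\<^sup>2 - y\<^sup>2 = (x + y) * (x - y)"
        by (simp add: power2_eq_square algebra_simps)
      moreover have "1 / (x * (x + y)) + 1 / (x * (x - y)) = 2 / ((x + y) * (x - y))"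
        using that by (simp add: divide_simps)
      ultimately show ?thesis
        by simp
    qed
    from this[OF nz(1-3)] have "h * (1 / (real_of_int m * (real_of_int m + 2 * real_of_int k))
        + 1 / (real_of_int m * (real_of_int m - 2 * real_of_int k))) = r"
      by (simp add: r_def power_mult_distrib)
    then show ?thesis
      unfolding freq_def den by (simp add: distrib_left)
  qed
  \<comment> \<open>Since m^2 < k^2, the denominator has modulus at least k^2; since k is nonzero,
    \<open>jbr k\<close> is at most 2|k|.\<close>
  have r: "\<bar>r\<bar> \<le> 8 * h / (jbr k * jbr k)"
  proof -
    have "real_of_int (m\<^sup>2) < real_of_int (k\<^sup>2)"
      using m2 by (simp only: of_int_less_iff)
    then have 1: "real_of_int (k\<^sup>2) \<le> \<bar>real_of_int (m\<^sup>2) - 4 * real_of_int (k\<^sup>2)\<bar>"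
      by linarith
    have "jbr k \<le> 2 * \<bar>real_of_int k\<bar>"
      using k0 by (simp add: jbr_def)
    then have "jbr k * jbr k \<le> (2 * \<bar>real_of_int k\<bar>) * (2 * \<bar>real_of_int k\<bar>)"
      by (intro mult_mono) auto
    then have "jbr k * jbr k \<le> 4 * \<bar>real_of_int (m\<^sup>2) - 4 * real_of_int (k\<^sup>2)\<bar>"
      using 1 by (simp add: power2_eq_square)
    moreover have "\<bar>real_of_int (m\<^sup>2) - 4 * real_of_int (k\<^sup>2)\<bar> > 0"
      using 1 k0 by (smt (verit) of_int_0_less_iff zero_less_power2 abs_zero)
    moreover have "jbr k * jbr k > 0" by simp
    ultimately have "2 * h / \<bar>real_of_int (m\<^sup>2) - 4 * real_of_int (k\<^sup>2)\<bar> \<le> 8 * h / (jbr k * jbr k)"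
      using h_pos by (simp add: divide_le_eq le_divide_eq mult_ac)
    then show ?thesis
      using h_pos by (simp add: r_def)
  qed
  have "cmod (N k l k t + N k (2 * k - l) k t) \<le> 2 * pi * ((\<kappa> * w1 (k - l)) * (\<kappa> * w1 (l - k)) * (8 * h / (jbr k * jbr k)))"
  proof (rule norm_le_of_derivative_le_const[where f = "\<lambda>t. N k l k t + N k (2 * k - l) k t", OF _ _ _ t])
    fix s :: real assume s: "s \<in> {0..2*pi}"
    \<comment> \<open>On the diagonal the residual phase is 1. Reflection swaps the two amplitudes,
      so both terms share a numerator and only the inverse frequencies add.\<close>
    have eq: "Nd k l k s * cis (freq k k * s) + Nd k (2 * k - l) k s * cis (freq k k * s)
        = f (k - l) s * f (l - k) s * (- \<i> * of_real r)"
    proof -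
      have "k - (2 * k - l) = l - k" "(2 * k - l) - k = k - l" by simp_all
      then have "Nd k l k s * cis (freq k k * s) + Nd k (2 * k - l) k s * cis (freq k k * s)
          = f (k - l) s * f (l - k) s * (- \<i> * of_real (1 / freq l k + 1 / freq (2 * k - l) k))"
        by (simp add: Nd_def freq_def[of k k] divide_inverse algebra_simps)
      then show ?thesis unfolding inv .
    qed
    show "((\<lambda>t. N k l k t + N k (2 * k - l) k t) has_vector_derivative f (k - l) s * f (l - k) s * (- \<i> * of_real r))
        (at s within {0..2*pi})"
      unfolding eq[symmetric] by (intro has_vector_derivative_add N_deriv s)
    have "cmod (f (k - l) s * f (l - k) s * (- \<i> * of_real r)) = cmod (f (k - l) s) * cmod (f (l - k) s) * \<bar>r\<bar>"
      by (simp add: norm_mult)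
    also have "\<dots> \<le> (\<kappa> * w1 (k - l)) * (\<kappa> * w1 (l - k)) * (8 * h / (jbr k * jbr k))"
      using r \<kappa>_pos w_le_w1 by (intro mult_mono order_trans[OF f_le(1)]) auto
    finally show "cmod (f (k - l) s * f (l - k) s * (- \<i> * of_real r))
        \<le> (\<kappa> * w1 (k - l)) * (\<kappa> * w1 (l - k)) * (8 * h / (jbr k * jbr k))" .
  qed auto
  also have "\<dots> = 16 * pi * \<kappa> * (\<kappa> * h) * q k l k"
    by (simp add: q_def)
  finally show ?thesis
    by (simp add: K4_def)
qed

section \<open>The second Dyson term off and on the diagonal\<close>

definition Ct :: real where
  "Ct = K1 + K2 + K3 + 4 * K4"

text \<open>Only l^2 \<noteq> k^2 with j^2 = k^2 leaves a phase that cannot be integrated by parts.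
  The hypothesis \<open>cases\<close> postpones that situation, since the diagonal and the
  antidiagonal treat it differently.\<close>

lemma Tm_le:
  assumes t: "t \<in> {0..2*pi}"
    and cases: "l\<^sup>2 \<noteq> k\<^sup>2 \<Longrightarrow> j\<^sup>2 = k\<^sup>2 \<Longrightarrow>
       jbr j * jbr k \<le> 2 * \<bar>real_of_int (l\<^sup>2 - k\<^sup>2)\<bar> * (jbr (j - l) * jbr (l - k))"
  shows "cmod (Tm j l k t) \<le> Ct * q j l k"
proof -
  consider "l\<^sup>2 = k\<^sup>2" | "l\<^sup>2 \<noteq> k\<^sup>2" "j\<^sup>2 \<noteq> k\<^sup>2" | "l\<^sup>2 \<noteq> k\<^sup>2" "j\<^sup>2 = k\<^sup>2" by blast
  then obtain C where C: "cmod (Tm j l k t) \<le> C * q j l k" "C \<le> Ct"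
  proof cases
    case 1
    show ?thesis
      by (rule that[OF Tm_le_of_eq_right[OF 1 t]]) (use K_nonneg in \<open>simp add: Ct_def\<close>)
  next
    case 2
    have "cmod (Tm j l k t) \<le> cmod (Tm j l k t - N j l k t) + cmod (N j l k t)"
      using norm_triangle_ineq[of "Tm j l k t - N j l k t" "N j l k t"] by simp
    also have "\<dots> \<le> K2 * q j l k + K3 * q j l k"
      by (intro add_mono Tm_minus_N_le N_le_of_neq 2 t)
    also have "\<dots> = (K2 + K3) * q j l k"
      by (simp only: distrib_right)
    finally show ?thesis
      by (rule that) (use K_nonneg in \<open>simp add: Ct_def\<close>)
  next
    case 3
    have "cmod (Tm j l k t) \<le> cmod (Tm j l k t - N j l k t) + cmod (N j l k t)"
      using norm_triangle_ineq[of "Tm j l k t - N j l k t" "N j l k t"] by simp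
    also have "\<dots> \<le> K2 * q j l k + K4 * q j l k"
      by (intro add_mono Tm_minus_N_le N_le_of_large 3 t cases)
    also have "\<dots> = (K2 + K4) * q j l k"
      by (simp only: distrib_right)
    finally show ?thesis
      by (rule that) (use K_nonneg in \<open>simp add: Ct_def\<close>)
  qed
  then show ?thesis
    by (meson mult_right_mono order_trans q_nonneg)
qed

text \<open>For j = -k the two hops together cover the distance 2|k|. Their spare powers yield one
  factor \<open>jbr k\<close>, and l^2 - k^2 yields the other.\<close>

lemma Tm_le_offdiag:
  assumes jk: "j \<noteq> k" and t: "t \<in> {0..2*pi}"
  shows "cmod (Tm j l k t) \<le> Ct * q j l k"
proof (rule Tm_le[OF t])
  assume l: "l\<^sup>2 \<noteq> k\<^sup>2" and "j\<^sup>2 = k\<^sup>2"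
  then have j: "j = - k" using jk by (auto simp: power2_eq_iff)
  have "jbr k \<le> jbr (j - k)"
    unfolding j by (rule jbr_mono) simp
  also have "\<dots> \<le> jbr (j - l) * jbr (l - k)"
    using jbr_add_le[of "j - l" "l - k"] by simp
  finally have "jbr k * jbr k \<le> (2 * \<bar>real_of_int (l\<^sup>2 - k\<^sup>2)\<bar>) * (jbr (j - l) * jbr (l - k))"
    by (intro mult_mono jbr_le_square_diff[OF l]) auto
  then show "jbr j * jbr k \<le> 2 * \<bar>real_of_int (l\<^sup>2 - k\<^sup>2)\<bar> * (jbr (j - l) * jbr (l - k))"
    by (simp add: j)
qed

lemma q_reflect: "q k (2 * k - l) k = q k l k"
proof -
  have "k - (2 * k - l) = l - k" "(2 * k - l) - k = k - l" by simp_all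
  then show ?thesis by (simp add: q_def)
qed

text \<open>Modes closer to k than |k| rely on the cancellation in \<open>N_reflect_le\<close>. For
  farther ones each hop has length at least |k|, so both gains come from the hop weights and each
  term is bounded separately.\<close>

lemma Tm_diag_reflect_le:
  assumes t: "t \<in> {0..2*pi}"
  shows "cmod (Tm k l k t + Tm k (2 * k - l) k t) \<le> 2 * Ct * q k l k"
proof (cases "l \<noteq> k \<and> \<bar>l - k\<bar> < \<bar>k\<bar>")
  case True
  let ?l' = "2 * k - l"
  \<comment> \<open>The exceptional modes l = -k and l = 3k lie at distance 2|k| from k and are
    excluded.\<close>
  have "l\<^sup>2 \<noteq> k\<^sup>2" "?l'\<^sup>2 \<noteq> k\<^sup>2"
    using True by (auto simp: power2_eq_iff)
  note * = Tm_minus_N_le[OF this(1) t, of k] Tm_minus_N_le[OF this(2) t, of k]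
  let ?A = "K2"
  have "Tm k l k t + Tm k ?l' k t =
      ((Tm k l k t - N k l k t) + (Tm k ?l' k t - N k ?l' k t)) + (N k l k t + N k ?l' k t)"
    by simp
  then have "cmod (Tm k l k t + Tm k ?l' k t) \<le>
      (cmod (Tm k l k t - N k l k t) + cmod (Tm k ?l' k t - N k ?l' k t)) + cmod (N k l k t + N k ?l' k t)"
    by (metis norm_triangle_ineq norm_triangle_mono order_refl)
  also have "\<dots> \<le> (?A * q k l k + ?A * q k l k) + 4 * K4 * q k l k"
    using * N_reflect_le[of l k t] True t unfolding q_reflect by (intro add_mono) auto
  also have "\<dots> = (2 * ?A + 4 * K4) * q k l k"
    by (simp add: algebra_simps)
  also have "\<dots> \<le> 2 * Ct * q k l k"
    using K_nonneg by (intro mult_right_mono) (auto simp: Ct_def)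
  finally show ?thesis .
next
  case False
  have *: "cmod (Tm k l k t) \<le> Ct * q k l k" if "l = k \<or> \<bar>k\<bar> \<le> \<bar>l - k\<bar>" for l
  proof (rule Tm_le[OF t])
    assume l: "l\<^sup>2 \<noteq> k\<^sup>2"
    then have "l \<noteq> k" by auto
    then have "\<bar>k\<bar> \<le> \<bar>l - k\<bar>" "\<bar>k\<bar> \<le> \<bar>k - l\<bar>" using that by auto
    then have "jbr k * jbr k \<le> jbr (k - l) * jbr (l - k)"
      by (intro mult_mono jbr_mono) auto
    moreover have "1 \<le> 2 * \<bar>real_of_int (l\<^sup>2 - k\<^sup>2)\<bar>"
      using jbr_le_square_diff(1)[OF l] jbr_ge_1[of k] by linarith
    ultimately have "1 * (jbr k * jbr k) \<le> 2 * \<bar>real_of_int (l\<^sup>2 - k\<^sup>2)\<bar> * (jbr (k - l) * jbr (l - k))"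
      by (intro mult_mono[of 1 _ "jbr k * jbr k"]) auto
    then show "jbr k * jbr k \<le> 2 * \<bar>real_of_int (l\<^sup>2 - k\<^sup>2)\<bar> * (jbr (k - l) * jbr (l - k))"
      by simp
  qed
  have "cmod (Tm k l k t + Tm k (2 * k - l) k t) \<le> Ct * q k l k + Ct * q k (2 * k - l) k"
    by (intro norm_triangle_mono *) (use False in auto)
  then show ?thesis
    by (simp add: q_reflect)
qed

end

subsection \<open>Columns of the fundamental solution\<close>

lemma power_over_fact_tendsto_0:
  fixes x :: real
  shows "(\<lambda>n. x ^ n / fact n) \<longlonglongrightarrow> 0"
  using summable_LIMSEQ_zero[OF summable_exp[of x]] by (simp add: field_simps)

locale column = smooth_potential +
  fixes W :: "real \<Rightarrow> int \<Rightarrow> int \<Rightarrow> complex" and k :: int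
  assumes W: "fundamental_solution h v W"
begin

definition \<phi> :: "int \<Rightarrow> real \<Rightarrow> complex" where
  "\<phi> j t = cis (of_int (j\<^sup>2) / h * t) * W t j k"

definition z :: "int \<Rightarrow> real \<Rightarrow> complex" where
  "z j t = \<phi> j t - (if j = k then 1 else 0)"

text \<open>What remains of \<open>\<phi>\<close> after the Dyson terms of order zero and
  one.\<close>

definition y :: "int \<Rightarrow> real \<Rightarrow> complex" where
  "y j t = z j t - B j k t"

text \<open>Unitarity gives a bound uniform in the modes, from which the iteration can
  start.\<close>

lemma W_le_1: "cmod (W t j k) \<le> 1"
proof -
  have "((\<lambda>j. (cmod (W t j k))\<^sup>2) has_sum 1) UNIV"
    using W by (simp add: fundamental_solution_def)
  from finite_sum_le_has_sum[OF this, of "{j}"] have "(cmod (W t j k))\<^sup>2 \<le> 1"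
    by simp
  then show ?thesis
    by (simp add: power_le_one_iff)
qed

lemma \<phi>_le_1: "cmod (\<phi> j t) \<le> 1"
  using W_le_1 by (simp add: \<phi>_def norm_mult)

lemma z_le_2: "cmod (z j t) \<le> 2"
  using norm_triangle_ineq4[of "\<phi> j t" "if j = k then 1 else 0"] \<phi>_le_1[of j t]
  by (auto simp: z_def split: if_splits)

lemma z_0 [simp]: "z j 0 = 0"
  using W by (simp add: z_def \<phi>_def fundamental_solution_def)

lemma y_0 [simp]: "y j 0 = 0"
  by (simp add: y_def)

section \<open>The equation in the interaction picture and a priori decay\<close>

lemma a_summable:
  assumes "\<And>l. cmod (x l) \<le> M"
  shows "(\<lambda>l. a j l t * x l) summable_on UNIV"
proof (rule norm_infsum_le(1))
  show "(\<lambda>l. \<kappa> * w1 (j - l) * M) summable_on UNIV"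
    by (intro summable_on_cmult_left summable_on_cmult_right summable_on_diff_left w1_summable)
  show "cmod (a j l t * x l) \<le> \<kappa> * w1 (j - l) * M" for l
    unfolding norm_mult using \<kappa>_pos by (intro mult_mono a_le_w1 assms) auto
qed

lemma \<phi>_deriv: "(\<phi> j has_vector_derivative (\<Sum>\<^sub>\<infinity>l. a j l t * \<phi> l t)) (at t within S)"
proof -
  let ?e = "cis (of_int (j\<^sup>2) / h * t)"
  let ?S = "\<Sum>\<^sub>\<infinity>l. v (j - l) t * W t l k"
  have "((\<lambda>t. W t j k) has_vector_derivative
      (of_int j ^ 2 * W t j k + ?S) / (\<i> * of_real h)) (at t within S)"
    using W by (simp add: fundamental_solution_def has_vector_derivative_at_within)
  then have "(\<phi> j has_vector_derivative
      ?e * ((of_int j ^ 2 * W t j k + ?S) / (\<i> * of_real h))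
      + (\<i> * of_real (of_int (j\<^sup>2) / h) * ?e) * W t j k) (at t within S)"
    unfolding \<phi>_def[abs_def] by (intro has_vector_derivative_mult has_vector_derivative_cis_mult)
  \<comment> \<open>The free term cancels because 1 / (ih) + i / h = 0.\<close>
  moreover have "?e * ((of_int j ^ 2 * W t j k + ?S) / (\<i> * of_real h))
      + (\<i> * of_real (of_int (j\<^sup>2) / h) * ?e) * W t j k = (?e / (\<i> * of_real h)) * ?S"
    using h_pos by (simp add: field_simps)
  moreover have "(?e / (\<i> * of_real h)) * ?S = (\<Sum>\<^sub>\<infinity>l. a j l t * \<phi> l t)"
  proof -
    have "(?e / (\<i> * of_real h)) * (v (j - l) t * W t l k) = a j l t * \<phi> l t" for l
    proof -
      have "cis (freq j l * t) * cis (of_int (l\<^sup>2) / h * t) = ?e"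
        by (simp add: freq_def cis_mult diff_divide_distrib algebra_simps)
      then show ?thesis
        by (simp add: a_def f_def \<phi>_def mult_ac)
    qed
    then show ?thesis
      by (simp flip: infsum_cmult_right')
  qed
  ultimately show ?thesis
    by simp
qed

lemma z_deriv:
  "(z j has_vector_derivative a j k t + (\<Sum>\<^sub>\<infinity>l. a j l t * z l t)) (at t within S)"
proof -
  have "(\<Sum>\<^sub>\<infinity>l. a j l t * \<phi> l t) = (\<Sum>\<^sub>\<infinity>l. a j l t * (if l = k then 1 else 0) + a j l t * z l t)"
    by (intro infsum_cong) (auto simp: z_def right_diff_distrib)
  also have "\<dots> = (\<Sum>\<^sub>\<infinity>l. a j l t * (if l = k then 1 else 0)) + (\<Sum>\<^sub>\<infinity>l. a j l t * z l t)"
    by (intro infsum_add a_summable[of _ 1] a_summable[of _ 2] z_le_2) auto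
  also have "(\<Sum>\<^sub>\<infinity>l. a j l t * (if l = k then 1 else 0)) = (\<Sum>\<^sub>\<infinity>l\<in>{k}. a j l t)"
    by (rule infsum_cong_neutral) auto
  finally have "(\<Sum>\<^sub>\<infinity>l. a j l t * \<phi> l t) = a j k t + (\<Sum>\<^sub>\<infinity>l. a j l t * z l t)"
    by simp
  then show ?thesis
    using \<phi>_deriv[of j t S] unfolding z_def[abs_def] by (simp add: has_vector_derivative_diff_const)
qed

lemma y_deriv:
  assumes "t \<in> {0..2*pi}"
  shows "(y j has_vector_derivative (\<Sum>\<^sub>\<infinity>l. a j l t * z l t)) (at t within {0..2*pi})"
proof -
  have "((\<lambda>t. z j t - B j k t) has_vector_derivative
      (a j k t + (\<Sum>\<^sub>\<infinity>l. a j l t * z l t)) - a j k t) (at t within {0..2*pi})"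
    by (intro has_vector_derivative_diff z_deriv B_deriv assms)
  then show ?thesis
    by (simp add: y_def[abs_def])
qed

text \<open>Bounds made of a weighted part and a flat part are stable under the generator:
  convolution multiplies the first by \<kappa> D, summation of the weight multiplies the second by
  \<kappa> Z.\<close>

lemma infsum_a_le:
  assumes x: "\<And>l. cmod (x l) \<le> A * w1 (l - k) + R" and A: "A \<ge> 0" and R: "R \<ge> 0"
  shows "cmod (\<Sum>\<^sub>\<infinity>l. a j l t * x l) \<le> \<kappa> * A * D * w1 (j - k) + \<kappa> * Z * R"
proof -
  have p: "\<alpha> - 1 > 1" using \<alpha>_gt by simp
  note conv = wt_convolution[OF \<beta>_nonneg p, of j k]
  have s1: "(\<lambda>l. (\<kappa> * A) * (w1 (j - l) * w1 (l - k))) summable_on UNIV"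
    by (intro summable_on_cmult_right conv(1))
  have s2: "(\<lambda>l. (\<kappa> * R) * w1 (j - l)) summable_on UNIV"
    by (intro summable_on_cmult_right summable_on_diff_left w1_summable)
  have "cmod (\<Sum>\<^sub>\<infinity>l. a j l t * x l)
      \<le> (\<Sum>\<^sub>\<infinity>l. (\<kappa> * A) * (w1 (j - l) * w1 (l - k)) + (\<kappa> * R) * w1 (j - l))"
  proof (rule norm_infsum_le(2)[OF summable_on_add[OF s1 s2]])
    fix l
    have "cmod (a j l t * x l) \<le> (\<kappa> * w1 (j - l)) * (A * w1 (l - k) + R)"
      unfolding norm_mult using \<kappa>_pos by (intro mult_mono a_le_w1 x) auto
    then show "cmod (a j l t * x l) \<le> (\<kappa> * A) * (w1 (j - l) * w1 (l - k)) + (\<kappa> * R) * w1 (j - l)"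
      by (simp add: algebra_simps)
  qed
  also have "\<dots> = (\<kappa> * A) * (\<Sum>\<^sub>\<infinity>l. w1 (j - l) * w1 (l - k)) + (\<kappa> * R) * (\<Sum>\<^sub>\<infinity>l. w1 l)"
    unfolding infsum_add[OF s1 s2] infsum_cmult_right' infsum_diff_left[of w1] ..
  also have "\<dots> \<le> (\<kappa> * A) * (D * w1 (j - k)) + (\<kappa> * R) * Z"
    using \<kappa>_pos A R by (intro add_mono mult_left_mono conv(2) wt_infsum_le \<beta>_nonneg p) auto
  finally show ?thesis
    by (simp add: mult_ac)
qed

text \<open>Picard iteration started from the trivial bound \<open>2\<close> replaces Gronwall's inequality, whose
  supremum over the infinitely many modes would not be controlled beforehand.\<close>
lemma z_le_iterate:
  assumes "t \<in> {0..2*pi}"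
  shows "cmod (z j t) \<le> b / jbr k * exp (\<kappa> * D * t) * w1 (j - k) + 2 * (\<kappa> * Z * t) ^ n / fact n"
  using assms
proof (induction n arbitrary: j t)
  case 0
  have "0 \<le> b / jbr k * exp (\<kappa> * D * t) * w1 (j - k)"
    using b_pos by simp
  then show ?case
    using z_le_2[of j t] by simp
next
  case (Suc n)
  let ?A = "\<lambda>s. b / jbr k * exp (\<kappa> * D * s)" and ?R = "\<lambda>s. 2 * (\<kappa> * Z * s) ^ n / fact n"
  \<comment> \<open>This majorant integrates the bound of \<open>infsum_a_le\<close> exactly: the
    exponential absorbs \<kappa> D, and the flat term of order n becomes that of order n + 1. Its
    value at 0 is what the bound on \<open>B j k\<close> adds back at the end.\<close>
  let ?g = "\<lambda>s. ?A s * w1 (j - k) + 2 * (\<kappa> * Z * s) ^ Suc n / fact (Suc n)"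
  have "cmod (y j t - y j 0) \<le> ?g t - ?g 0"
  proof (rule norm_diff_le_of_derivative_le[OF y_deriv _ _ Suc.prems])
    fix s :: real assume s: "s \<in> {0..2*pi}"
    have "((\<lambda>s. (\<kappa> * Z * s) ^ Suc n) has_vector_derivative (1 + of_nat n) * (\<kappa> * Z * s) ^ n * (\<kappa> * Z)) (at s within {0..2*pi})"
      unfolding has_real_derivative_iff_has_vector_derivative[symmetric]
      by (auto intro!: derivative_eq_intros simp del: power_Suc)
    then have d1: "((\<lambda>s. 2 * (\<kappa> * Z * s) ^ Suc n / fact (Suc n)) has_vector_derivative
        2 * ((1 + of_nat n) * (\<kappa> * Z * s) ^ n * (\<kappa> * Z)) / fact (Suc n)) (at s within {0..2*pi})"
      by (intro has_vector_derivative_divide has_vector_derivative_mult_right)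
    have eq: "2 * ((1 + of_nat n) * (\<kappa> * Z * s) ^ n * (\<kappa> * Z)) / fact (Suc n) = \<kappa> * Z * ?R s"
    proof -
      have "2 * (m * X * K) / (m * F) = K * (2 * X / F)" if "m \<noteq> 0" for m X K F :: real
        using that by simp
      from this[of "1 + of_nat n"] show ?thesis
        unfolding fact_Suc of_nat_Suc by simp
    qed
    have d2: "((\<lambda>s. ?A s * w1 (j - k)) has_vector_derivative \<kappa> * ?A s * D * w1 (j - k)) (at s within {0..2*pi})"
      unfolding has_real_derivative_iff_has_vector_derivative[symmetric]
      by (auto intro!: derivative_eq_intros)
    show "(?g has_vector_derivative \<kappa> * ?A s * D * w1 (j - k) + \<kappa> * Z * ?R s) (at s within {0..2*pi})"
      by (rule has_vector_derivative_add[OF d2 d1[unfolded eq]])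
    show "cmod (\<Sum>\<^sub>\<infinity>l. a j l s * z l s) \<le> \<kappa> * ?A s * D * w1 (j - k) + \<kappa> * Z * ?R s"
      using s b_pos \<kappa>_pos jbr_zeta_nonneg by (intro infsum_a_le Suc.IH) auto
  qed
  then have "cmod (y j t) \<le> ?g t - b / jbr k * w1 (j - k)"
    by simp
  moreover have "cmod (B j k t) \<le> b * w1 (j - k) / jbr k"
    using Suc.prems by (intro B_le) auto
  moreover have "cmod (z j t) \<le> cmod (y j t) + cmod (B j k t)"
    using norm_triangle_ineq[of "y j t" "B j k t"] by (simp add: y_def)
  ultimately show ?case
    by simp
qed

definition g :: real where
  "g = b * exp (\<kappa> * D * (2 * pi))"

lemma g_pos: "g > 0"
  using b_pos by (simp add: g_def)

text \<open>As n tends to infinity the flat part of \<open>z_le_iterate\<close> vanishes, and decay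
  away from k with a gain at k remains.\<close>

lemma z_le:
  assumes t: "t \<in> {0..2*pi}"
  shows "cmod (z j t) \<le> g * w1 (j - k) / jbr k"
proof -
  have "(\<lambda>n. b / jbr k * exp (\<kappa> * D * t) * w1 (j - k) + 2 * ((\<kappa> * Z * t) ^ n / fact n))
      \<longlonglongrightarrow> b / jbr k * exp (\<kappa> * D * t) * w1 (j - k) + 2 * 0"
    by (intro tendsto_intros power_over_fact_tendsto_0)
  then have "cmod (z j t) \<le> b / jbr k * exp (\<kappa> * D * t) * w1 (j - k) + 2 * 0"
    by (rule LIMSEQ_le_const) (use z_le_iterate[OF t] in auto)
  also have "\<dots> \<le> b / jbr k * exp (\<kappa> * D * (2 * pi)) * w1 (j - k) + 2 * 0"
    using t b_pos \<kappa>_pos conv_const_nonneg by (intro add_mono mult_mono) (auto intro: mult_left_mono)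
  finally show ?thesis
    by (simp add: g_def)
qed

text \<open>One constant for y and its derivative, as \<open>norm_primitive_mult_le\<close> asks for
  a common bound.\<close>

definition Cy :: real where
  "Cy = g + b + \<kappa> * g * D"

lemma y_le:
  assumes t: "t \<in> {0..2*pi}"
  shows "cmod (y j t) \<le> Cy * w1 (j - k) / jbr k"
    and "cmod (\<Sum>\<^sub>\<infinity>l. a j l t * z l t) \<le> Cy * w1 (j - k) / jbr k"
proof -
  have nn: "0 \<le> \<kappa> * g * D"
    using \<kappa>_pos g_pos conv_const_nonneg by simp
  have "cmod (y j t) \<le> cmod (z j t) + cmod (B j k t)"
    by (simp add: y_def norm_triangle_ineq4)
  also have "\<dots> \<le> g * w1 (j - k) / jbr k + b * w1 (j - k) / jbr k"
    using t by (intro add_mono z_le B_le) auto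
  also have "\<dots> = (g + b) * (w1 (j - k) / jbr k)"
    by (simp add: algebra_simps add_divide_distrib)
  also have "\<dots> \<le> Cy * (w1 (j - k) / jbr k)"
    using nn by (intro mult_right_mono) (auto simp: Cy_def)
  finally show "cmod (y j t) \<le> Cy * w1 (j - k) / jbr k"
    by simp
  have "cmod (\<Sum>\<^sub>\<infinity>l. a j l t * z l t) \<le> \<kappa> * (g / jbr k) * D * w1 (j - k) + \<kappa> * Z * 0"
    using z_le[OF t] g_pos by (intro infsum_a_le) auto
  also have "\<dots> = (\<kappa> * g * D) * (w1 (j - k) / jbr k)"
    by simp
  also have "\<dots> \<le> Cy * (w1 (j - k) / jbr k)"
    using g_pos b_pos by (intro mult_right_mono) (auto simp: Cy_def)
  finally show "cmod (\<Sum>\<^sub>\<infinity>l. a j l t * z l t) \<le> Cy * w1 (j - k) / jbr k"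
    by simp
qed

text \<open>The Dyson terms of order three and higher whose last hop goes from l to j.\<close>

definition U :: "int \<Rightarrow> int \<Rightarrow> real \<Rightarrow> complex" where
  "U j l = prim (\<lambda>s. a j l s * y l s)"

lemma U_0 [simp]: "U j l 0 = 0"
  by (simp add: U_def)

lemma U_deriv:
  "t \<in> {0..2*pi} \<Longrightarrow> (U j l has_vector_derivative a j l t * y l t) (at t within {0..2*pi})"
proof -
  have "continuous_on {0..2*pi} (y l)"
    by (rule continuous_on_vector_derivative) (rule y_deriv)
  then show "t \<in> {0..2*pi} \<Longrightarrow> ?thesis"
    unfolding U_def by (intro prim_has_vector_derivative continuous_intros)
qed

text \<open>Both y and its derivative already carry the gain at k, so integration by parts against
  \<open>B j l\<close> adds the gain at j without any case distinction on resonances.\<close>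

lemma U_le:
  assumes t: "t \<in> {0..2*pi}"
  shows "cmod (U j l t) \<le> (1 + 2 * pi) * b * Cy * q j l k"
proof -
  have "cmod (U j l t) \<le> (1 + 2 * pi) * ((b * w1 (j - l) / jbr j) * (Cy * w1 (l - k) / jbr k))"
    by (rule norm_primitive_mult_le[OF B_deriv _ y_deriv U_deriv]) (use t in \<open>auto intro: B_le y_le\<close>)
  then show ?thesis
    by (simp add: q_def mult_ac)
qed

lemma y_has_sum:
  assumes t: "t \<in> {0..2*pi}"
  shows "((\<lambda>l. Tm j l k t + U j l t) has_sum y j t) UNIV"
proof (rule has_sum_of_derivative_infsum[OF _ _ y_deriv _ _ _ t])
  show "((\<lambda>t. Tm j l k t + U j l t) has_vector_derivative a j l s * z l s) (at s within {0..2*pi})"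
    if s: "s \<in> {0..2*pi}" for l s
    using has_vector_derivative_add[OF Tm_deriv[OF s, of j l k] U_deriv[OF s, of j l]]
    by (simp add: y_def algebra_simps)
  show "(\<lambda>l. \<kappa> * w1 (j - l) * 2) summable_on UNIV"
    by (intro summable_on_cmult_left summable_on_cmult_right summable_on_diff_left w1_summable)
  show "cmod (a j l s * z l s) \<le> \<kappa> * w1 (j - l) * 2" for l s
    unfolding norm_mult using \<kappa>_pos by (intro mult_mono a_le_w1 z_le_2) auto
qed auto

definition C2 :: real where
  "C2 = Ct + (1 + 2 * pi) * b * Cy"

section \<open>Summation over intermediate modes and assembly of the remainder\<close>

lemma q_infsum:
  shows "(\<lambda>l. q j l k) summable_on UNIV"
    and "(\<Sum>\<^sub>\<infinity>l. q j l k) \<le> D * w1 (j - k) / (jbr j * jbr k)"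
proof -
  have p: "\<alpha> - 1 > 1" using \<alpha>_gt by simp
  note conv = wt_convolution[OF \<beta>_nonneg p, of j k]
  have q: "q j l k = (1 / (jbr j * jbr k)) * (w1 (j - l) * w1 (l - k))" for l
    by (simp add: q_def)
  show "(\<lambda>l. q j l k) summable_on UNIV"
    unfolding q by (intro summable_on_cmult_right conv(1))
  have "(\<Sum>\<^sub>\<infinity>l. q j l k) = (1 / (jbr j * jbr k)) * (\<Sum>\<^sub>\<infinity>l. w1 (j - l) * w1 (l - k))"
    unfolding q infsum_cmult_right' ..
  also have "\<dots> \<le> (1 / (jbr j * jbr k)) * (D * w1 (j - k))"
    by (intro mult_left_mono conv(2)) auto
  finally show "(\<Sum>\<^sub>\<infinity>l. q j l k) \<le> D * w1 (j - k) / (jbr j * jbr k)"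
    by simp
qed

lemma C2_nonneg: "C2 \<ge> 0"
  using K_nonneg b_pos g_pos \<kappa>_pos conv_const_nonneg[of "\<alpha> - 1"]
  by (simp add: C2_def Ct_def Cy_def)

lemma second_order_le:
  assumes t: "t \<in> {0..2*pi}"
  shows "cmod (y j t) \<le> C2 * D * w1 (j - k) / (jbr j * jbr k)"
proof -
  have "cmod (y j t) \<le> C2 * (\<Sum>\<^sub>\<infinity>l. q j l k)"
  proof (cases "j = k")
    case False
    have "cmod (\<Sum>\<^sub>\<infinity>l. Tm j l k t + U j l t) \<le> (\<Sum>\<^sub>\<infinity>l. C2 * q j l k)"
    proof (rule norm_infsum_le(2)[OF summable_on_cmult_right[OF q_infsum(1)]])
      show "cmod (Tm j l k t + U j l t) \<le> C2 * q j l k" for l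
        using norm_triangle_mono[OF Tm_le_offdiag[OF False t] U_le[OF t]]
        by (simp add: C2_def distrib_right)
    qed
    then show ?thesis
      using infsumI[OF y_has_sum[OF t]] by (simp add: infsum_cmult_right')
  next
    case True
    let ?H = "\<lambda>l. Tm k l k t + U k l t"
    have H: "(?H has_sum y k t) UNIV"
      by (rule y_has_sum[OF t])
    \<comment> \<open>The reflection permutes the modes, so twice the sum is a sum over reflected
      pairs and the diagonal cancellation becomes available termwise.\<close>
    moreover have "((\<lambda>l. ?H (2 * k - l)) has_sum y k t) UNIV"
      using H has_sum_reindex_bij_betw[OF bij_int_diff_left, of ?H "2 * k"] by simp
    ultimately have "((\<lambda>l. ?H l + ?H (2 * k - l)) has_sum y k t + y k t) UNIV"
      by (rule has_sum_add)
    then have "y k t + y k t = (\<Sum>\<^sub>\<infinity>l. ?H l + ?H (2 * k - l))"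
      by (simp add: infsumI)
    moreover have "cmod (\<Sum>\<^sub>\<infinity>l. ?H l + ?H (2 * k - l)) \<le> (\<Sum>\<^sub>\<infinity>l. 2 * C2 * q k l k)"
    proof (rule norm_infsum_le(2)[OF summable_on_cmult_right[OF q_infsum(1)]])
      fix l
      have "cmod ((Tm k l k t + Tm k (2 * k - l) k t) + (U k l t + U k (2 * k - l) t)) \<le>
          2 * Ct * q k l k + ((1 + 2 * pi) * b * Cy * q k l k + (1 + 2 * pi) * b * Cy * q k (2 * k - l) k)"
        by (intro norm_triangle_mono Tm_diag_reflect_le U_le t)
      then show "cmod (?H l + ?H (2 * k - l)) \<le> 2 * C2 * q k l k"
        unfolding q_reflect by (simp add: C2_def algebra_simps)
    qed
    moreover have "cmod (y k t + y k t) = 2 * cmod (y k t)"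
      by (metis mult_2 norm_mult norm_numeral)
    ultimately have "2 * cmod (y k t) \<le> 2 * (C2 * (\<Sum>\<^sub>\<infinity>l. q k l k))"
      by (simp add: infsum_cmult_right' mult.assoc)
    then show ?thesis
      using True by simp
  qed
  also have "\<dots> \<le> C2 * (D * w1 (j - k) / (jbr j * jbr k))"
    by (intro mult_left_mono q_infsum C2_nonneg)
  finally show ?thesis
    by simp
qed

text \<open>On the diagonal everything vanishes, and on the antidiagonal the integral is exactly
  \<open>Md\<close>. Elsewhere the boundary terms of one integration by parts are \<open>M1\<close>,
  and the remainder of order \<theta>^-2 pays for a gain at each end.\<close>

lemma first_order_le:
  "cmod (ph h j * B j k (2 * pi) - Md h v j k - M1 h v j k)
     \<le> 4 * (2 + 2 * pi) * c * h * w1 (j - k) / (jbr j * jbr k)"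
proof -
  have ph: "ph h i = cis (- (of_int (i\<^sup>2) / h * (2 * pi)))" for i
    unfolding ph_def cis_conv_exp using h_pos by (intro arg_cong[of _ _ exp]) (simp add: field_simps)
  have rhs: "0 \<le> 4 * (2 + 2 * pi) * c * h * w1 (j - k) / (jbr j * jbr k)"
    using c_pos h_pos by simp
  consider "j = k" | "j = - k" "j \<noteq> k" | "j\<^sup>2 \<noteq> k\<^sup>2"
    using power2_eq_iff[of j k] by blast
  then show ?thesis
  proof cases
    case 1
    have "B k k (2 * pi) = 0"
      by (simp add: B_def prim_def fun_eq_iff[of "a k k" "\<lambda>_. 0", THEN iffD2])
    \<comment> \<open>At k = 0 diagonal and antidiagonal meet; there the zero mean of the potential
      is what makes \<open>Md\<close> vanish.\<close>
    moreover have "Md h v k k = 0"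
    proof (cases "k = 0")
      case True
      have "v 0 = (\<lambda>_. 0)" by (simp add: v_zero fun_eq_iff)
      then show ?thesis using True by (simp add: Md_def)
    qed (simp add: Md_def)
    ultimately show ?thesis
      using 1 rhs by (simp add: M1_def)
  next
    case 2
    have "a j k = (\<lambda>s. v (- 2 * k) s / (\<i> * of_real h))"
      using 2 by (simp add: fun_eq_iff a_def f_def freq_def)
    then have "B j k (2 * pi) = integral {0..2*pi} (v (- 2 * k)) / (\<i> * of_real h)"
      by (simp add: B_def prim_def)
    then have "ph h j * B j k (2 * pi) = Md h v j k"
      using 2 by (simp add: Md_def ph_def)
    then show ?thesis
      using 2 rhs by (simp add: M1_def)
  next
    case 3
    define \<theta> where "\<theta> = freq j k"
    have \<theta>0: "\<theta> \<noteq> 0" using 3 by (simp add: \<theta>_def freq_eq_0_iff)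
    have \<theta>: "of_real h * of_real \<theta> = (of_int (j\<^sup>2 - k\<^sup>2) :: complex)"
      using h_pos by (simp add: \<theta>_def freq_def)
    have nz: "(of_int (j\<^sup>2 - k\<^sup>2) :: complex) \<noteq> 0"
      using 3 by (simp only: of_int_eq_0_iff)
    \<comment> \<open>Periodicity in time gives both boundary terms the same coefficient, its value
      at time 0, as \<open>M1\<close> requires.\<close>
    have fp: "f (j - k) (2 * pi) = f (j - k) 0"
      using v_periodic[of "j - k" 0] by (simp add: f_def)
    let ?E = "(f (j - k) (2 * pi) * cis (\<theta> * (2 * pi)) - f (j - k) 0) / (\<i> * of_real \<theta>)"
    have phs: "ph h j * cis (\<theta> * (2 * pi)) = ph h k"
      by (simp add: ph \<theta>_def freq_def cis_mult diff_divide_distrib algebra_simps)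
    have "ph h j * ?E = v (j - k) 0 * (ph h j - ph h j * cis (\<theta> * (2 * pi))) / (of_real h * of_real \<theta>)"
      unfolding fp using \<theta>0 h_pos by (simp add: f_def field_simps)
    also have "\<dots> = v (j - k) 0 * (ph h k - ph h j) / of_int (k\<^sup>2 - j\<^sup>2)"
      unfolding \<theta> phs using minus_divide_divide[of "v (j - k) 0 * (ph h j - ph h k)" "of_int (j\<^sup>2 - k\<^sup>2)"]
      by (simp add: algebra_simps)
    also have "\<dots> = Md h v j k + M1 h v j k"
    proof -
      have "- j \<noteq> k" using 3 by auto
      then show ?thesis using 3 by (simp add: Md_def M1_def)
    qed
    finally have E: "ph h j * ?E = Md h v j k + M1 h v j k" .
    have "ph h j * B j k (2 * pi) - Md h v j k - M1 h v j k = ph h j * (B j k (2 * pi) - ?E)"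
      by (simp only: right_diff_distrib E) simp
    then have "cmod (ph h j * B j k (2 * pi) - Md h v j k - M1 h v j k) = cmod (B j k (2 * pi) - ?E)"
      by (simp add: norm_mult ph)
    also have "\<dots> \<le> (2 + 2 * pi) * (\<kappa> * w (j - k)) / \<theta>\<^sup>2"
    proof (rule norm_oscillatory_primitive_remainder_le[OF f_deriv f'_deriv])
      show "(B j k has_vector_derivative f (j - k) s * cis (\<theta> * s)) (at s within {0..2*pi})"
        if "s \<in> {0..2*pi}" for s
        using B_deriv[OF that] by (simp add: a_def \<theta>_def)
    qed (use \<theta>0 f_le in auto)
    also have "\<dots> = ((2 + 2 * pi) * (\<kappa> * w (j - k))) * ((1 / \<bar>\<theta>\<bar>) * (1 / \<bar>\<theta>\<bar>))"
      by (simp add: power2_eq_square)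
    also have "\<dots> \<le> ((2 + 2 * pi) * (\<kappa> * w1 (j - k))) * ((2 * h / jbr j) * (2 * h / jbr k))"
      unfolding \<theta>_def using h_pos \<kappa>_pos w_le_w1 by (intro mult_mono inverse_freq_le[OF 3]) auto
    also have "\<dots> = 4 * (2 + 2 * pi) * (\<kappa> * h) * h * w1 (j - k) / (jbr j * jbr k)"
      by (simp add: mult_ac del: \<kappa>_h)
    finally show ?thesis
      by simp
  qed
qed

lemma monodromy_remainder_le:
  "cmod (monodromy W j k - M0 h j k - Md h v j k - M1 h v j k)
     \<le> (C2 * D + 4 * (2 + 2 * pi) * c * h) * w1 (j - k) / (jbr j * jbr k)"
proof -
  have ph: "ph h j = cis (- (of_int (j\<^sup>2) / h * (2 * pi)))"
    unfolding ph_def cis_conv_exp using h_pos by (intro arg_cong[of _ _ exp]) (simp add: field_simps)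
  have "monodromy W j k = ph h j * \<phi> j (2 * pi)"
    by (simp add: monodromy_def \<phi>_def ph cis_mult flip: mult.assoc)
  also have "\<dots> = M0 h j k + ph h j * B j k (2 * pi) + ph h j * y j (2 * pi)"
    by (simp add: y_def z_def M0_def algebra_simps)
  finally have "monodromy W j k - M0 h j k - Md h v j k - M1 h v j k
      = ph h j * y j (2 * pi) + (ph h j * B j k (2 * pi) - Md h v j k - M1 h v j k)"
    by simp
  moreover have "cmod (ph h j * y j (2 * pi)) \<le> C2 * D * w1 (j - k) / (jbr j * jbr k)"
    using second_order_le[of "2 * pi" j] by (simp add: norm_mult ph)
  ultimately have "cmod (monodromy W j k - M0 h j k - Md h v j k - M1 h v j k)
      \<le> C2 * D * w1 (j - k) / (jbr j * jbr k) + 4 * (2 + 2 * pi) * c * h * w1 (j - k) / (jbr j * jbr k)"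
    by (simp only: norm_triangle_mono[OF _ first_order_le])
  then show ?thesis
    by (simp only: distrib_right add_divide_distrib)
qed

end

text \<open>Outside its locale \<open>C2\<close> takes only h, \<alpha> and c as arguments, so this
  constant is independent of \<beta>, the potential, the propagator and the matrix entry.\<close>

definition remainder_const :: "real \<Rightarrow> real \<Rightarrow> real \<Rightarrow> real" where
  "remainder_const h \<alpha> c = column.C2 h \<alpha> c * conv_const (\<alpha> - 1) + 4 * (2 + 2 * pi) * c * h"

theorem theorem3:
  fixes h \<alpha> c_v :: real
  assumes "h > 0" and "\<alpha> > 2" and "c_v > 0"
  shows "\<exists>c_M. \<forall>\<beta> v W. \<beta> \<ge> 0 \<longrightarrow> potential_class \<alpha> \<beta> c_v v \<longrightarrow>
           fundamental_solution h v W \<longrightarrow>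
           (\<forall>j k. cmod (monodromy W j k - M0 h j k - Md h v j k - M1 h v j k)
              \<le> c_M * exp (- \<beta> * \<bar>j - k\<bar>) / (jbr j * jbr k * jbr (j - k) powr (\<alpha> - 1)))"
proof (intro exI allI impI)
  fix \<beta> v W j k
  assume \<beta>: "\<beta> \<ge> 0" and pot: "potential_class \<alpha> \<beta> c_v v" and W: "fundamental_solution h v W"
  from pot have "\<forall>n. \<exists>d1 d2. (\<forall>t. (v n has_vector_derivative d1 t) (at t)) \<and>
      (\<forall>t. (d1 has_vector_derivative d2 t) (at t)) \<and>
      (\<forall>t. cmod (v n t) \<le> c_v * wt \<beta> \<alpha> n \<and> cmod (d1 t) \<le> c_v * wt \<beta> \<alpha> n \<and> cmod (d2 t) \<le> c_v * wt \<beta> \<alpha> n)"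
    unfolding potential_class_def wt_def mult.assoc by blast
  then obtain v' v'' where "\<And>n t. (v n has_vector_derivative v' n t) (at t)"
      "\<And>n t. (v' n has_vector_derivative v'' n t) (at t)"
      "\<And>n t. cmod (v n t) \<le> c_v * wt \<beta> \<alpha> n" "\<And>n t. cmod (v' n t) \<le> c_v * wt \<beta> \<alpha> n"
      "\<And>n t. cmod (v'' n t) \<le> c_v * wt \<beta> \<alpha> n"
    by metis
  then interpret column h \<alpha> \<beta> c_v v v' v'' W k
    using assms \<beta> pot W by unfold_locales (auto simp: potential_class_def has_vector_derivative_at_within)
  have "cmod (monodromy W j k - M0 h j k - Md h v j k - M1 h v j k)
      \<le> remainder_const h \<alpha> c_v * wt \<beta> (\<alpha> - 1) (j - k) / (jbr j * jbr k)"
    using monodromy_remainder_le by (simp add: remainder_const_def)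
  also have "\<dots> = remainder_const h \<alpha> c_v * exp (- \<beta> * \<bar>j - k\<bar>) / (jbr j * jbr k * jbr (j - k) powr (\<alpha> - 1))"
    unfolding wt_def powr_minus_divide[of _ "\<alpha> - 1"] by simp
  \<comment> \<open>The bound that \<open>exI\<close> left open is fixed here as
    \<open>remainder_const h \<alpha> c_v\<close>.\<close>
  finally show "cmod (monodromy W j k - M0 h j k - Md h v j k - M1 h v j k)
      \<le> remainder_const h \<alpha> c_v * exp (- \<beta> * \<bar>j - k\<bar>) / (jbr j * jbr k * jbr (j - k) powr (\<alpha> - 1))" .
qed

end
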